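(* Let $K=\mathbb{Q}(\sqrt{2})$ with ring of integers $\mathcal{O}_K$, and let $|q|<1$. Define \[ L_{1}(q) := \sum_{n \geq 1} \sum_{k=1}^{n} \frac{(q)_{n-1}(-1)^{n+k}q^{\binom{n+1}{2} + \binom{k+1}{2}} }{(q)_{n-k} (q)_{k-1} (1-q^{2k-1})},\qquad L_{2}(q) := \sum_{n \geq 0} \sum_{k=0}^{n} \frac{(q)_{n}(-1)^{n+k}q^{\binom{n+1}{2} + \binom{k+1}{2}} }{(q)_{n-k} (q)_{k} (1-q^{2k+1})}, \] \[ L_{3}(q) := q \sum_{n \geq 1} \sum_{k=1}^{n} \frac{(q)_{n-1}(-1)^{n+k}q^{\binom{n+1}{2} + \binom{k}{2}} }{(q)_{n-k} (q)_{k-1} (1-q^{2k-1})},\qquad L_{4}(q) := -1 + \sum_{n \geq 0} \sum_{k=0}^{n} \frac{(q)_{n}(-1)^{n+k}q^{\binom{n+1}{2}+ \binom{k}{2}} }{(q)_{n-k} (q)_{k} (1-q^{2k+1})}. \] Then \[ q^{-17} L_{1}(q^{32}) = \frac{1}{2} \sum_{\substack{\mathfrak{a} \subset \mathcal{O}_{K} \\ N(\mathfrak{a}) \equiv 15 \pmod{32}}} q^{N(\mathfrak{a})},\qquad q^{7} L_{2}(q^{32}) = \frac{1}{2} \sum_{\substack{\mathfrak{a} \subset \mathcal{O}_{K} \\ N(\mathfrak{a}) \equiv 7 \pmod{32}}} q^{N(\mathfrak{a})}, \] \[ q^{-33} L_{3}(q^{32}) = \frac{1}{2} \sum_{\substack{\mathfrak{a}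 \subset \mathcal{O}_{K} \\ N(\mathfrak{a}) \equiv 31 \pmod{32}}} q^{N(\mathfrak{a})},\qquad q^{-9} L_{4}(q^{32}) = \frac{1}{2} \sum_{\substack{\mathfrak{a} \subset \mathcal{O}_{K} \\ N(\mathfrak{a}) \equiv 23 \pmod{32}}} q^{N(\mathfrak{a})}. \]
   Context: For $n\in\mathbb{N}\cup\{\infty\}$, $(a)_n=(a;q)_n=\prod_{k=1}^{n}(1-aq^{k-1})$ (empty product $=1$). The sums on the right run over nonzero ideals $\mathfrak{a}$ of $\mathcal{O}_K$ with the given congruence condition on the absolute norm $N(\mathfrak{a})$ (each ideal counted once). *)

theory Defs
  imports "HOL-Algebra.QuotRing" "HOL-Analysis.Analysis"
begin

text \<open>The ring of integers of K = Q(sqrt 2) is Z[sqrt 2]; the pair (a,b) represents a + b sqrt 2.\<close>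
definition zs_mult :: "int \<times> int \<Rightarrow> int \<times> int \<Rightarrow> int \<times> int" where
  "zs_mult x y = (fst x * fst y + 2 * snd x * snd y, fst x * snd y + snd x * fst y)"

definition zs_add :: "int \<times> int \<Rightarrow> int \<times> int \<Rightarrow> int \<times> int" where
  "zs_add x y = (fst x + fst y, snd x + snd y)"

definition OK :: "(int \<times> int) ring" where
  "OK = \<lparr>carrier = UNIV, Group.monoid.mult = zs_mult, Group.monoid.one = (1, 0), Ring.ring.zero = (0, 0), Ring.ring.add = zs_add\<rparr>"

definition ideal_norm :: "(int \<times> int) set \<Rightarrow> nat" where
  "ideal_norm I = card (carrier (OK Quot I))"

definition nonzero_ideals :: "(int \<times> int) set set" where
  "nonzero_ideals = {I. ideal I OK \<and> I \<noteq> {(0, 0)}}"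

definition qpoch :: "complex \<Rightarrow> nat \<Rightarrow> complex" where
  "qpoch q n = (\<Prod>j<n. 1 - q * q ^ j)"

definition L1 :: "complex \<Rightarrow> complex" where
  "L1 q = (\<Sum>n. \<Sum>k\<in>{1..n}.
     qpoch q (n - 1) * (-1) ^ (n + k) * q ^ (((n + 1) choose 2) + ((k + 1) choose 2))
     / (qpoch q (n - k) * qpoch q (k - 1) * (1 - q ^ (2 * k - 1))))"

definition L2 :: "complex \<Rightarrow> complex" where
  "L2 q = (\<Sum>n. \<Sum>k\<in>{0..n}.
     qpoch q n * (-1) ^ (n + k) * q ^ (((n + 1) choose 2) + ((k + 1) choose 2))
     / (qpoch q (n - k) * qpoch q k * (1 - q ^ (2 * k + 1))))"

definition L3 :: "complex \<Rightarrow> complex" where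
  "L3 q = q * (\<Sum>n. \<Sum>k\<in>{1..n}.
     qpoch q (n - 1) * (-1) ^ (n + k) * q ^ (((n + 1) choose 2) + (k choose 2))
     / (qpoch q (n - k) * qpoch q (k - 1) * (1 - q ^ (2 * k - 1))))"

definition L4 :: "complex \<Rightarrow> complex" where
  "L4 q = -1 + (\<Sum>n. \<Sum>k\<in>{0..n}.
     qpoch q n * (-1) ^ (n + k) * q ^ (((n + 1) choose 2) + (k choose 2))
     / (qpoch q (n - k) * qpoch q k * (1 - q ^ (2 * k + 1))))"

end

(*
  Put Q = p^2. Since 1/(1 - z^2) is the average of 1/(1 - z) and 1/(1 + z), and z/(1 - z^2) half their
  difference, partial fractions turn the inner sums of L2(Q), L4(Q) into the even and odd parts in p of
  sum_n (Q)_n (-1)^n Q^(n(n+1)/2) / (p;Q)_(n+1); the same holds for L3(Q), L1(Q) with Q^(n(n+3)/2).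
  Here 1/(p;Q)_(n+1) is the beta-side of a Bailey pair whose alpha-side contains the partial theta sums
  sum_(i<=m) p^(-i(i+1)/2). Bailey's lemma, with a 1-phi-1 summation as conjugate pair, yields the sum of
  p^(4r^2+3r+e(2r+1)-i(i+1)/2) over i <= 2r and e in {0,1}, respectively a similar sum over i <= 2r+1.
  Completing squares, the exponents are (x^2 - 2y^2 - 7)/16 with x = 8r+3+2e, y = 2i+1, respectively
  (x^2 - 2y^2 + 1)/16 with x = 8r+7+2e: all x, y with 0 < 2y < x and x^2 - 2y^2 congruent to 7,
  respectively 15, modulo 16. The region 2|y| < x is a fundamental domain for the units of positive norm
  acting on elements of odd positive norm, every ideal of Z[sqrt 2] is principal, and the symmetry
  y -> -y accounts for the factor 1/2.
*)
theory Submission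
  imports Defs
begin

section \<open>Partial fractions\<close>

text \<open>The obstacle is that the alpha-sides contain partial theta sums, so that a Bailey pair
  cannot be verified by one hypergeometric telescoping. Summation by parts removes them: the factor
  that multiplies the theta sum is a difference, and the theta sum is replaced by its increments.
  Each increment consists of two monomials whose sum fits a second telescoping. Both pairs have the
  same beta-side 1/(p;Q)_(n+1), one relative to Q and one relative to Q^2. The second is forced by
  L1 and L3, whose sums start at n = 1: shifting n by one adds n to the exponent n(n+1)/2 of Q, up
  to a constant. The shape 2|y| < x of the fundamental domain comes from requiring symmetry under y
  -> -y: multiplication by 3 + 2 sqrt 2 carries the ray of 2 - sqrt 2 to the ray of 2 + sqrt
  2.\<close>

definition shifted_qpoch :: "complex \<Rightarrow> complex \<Rightarrow> nat \<Rightarrow> complex" where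
  "shifted_qpoch x q n = (\<Prod>j<n. 1 - x * q ^ j)"

lemma qpoch_0 [simp]: "qpoch q 0 = 1"
  by (simp add: qpoch_def)

lemma qpoch_Suc: "qpoch q (Suc n) = qpoch q n * (1 - q ^ Suc n)"
  by (simp add: qpoch_def)

lemma shifted_qpoch_0 [simp]: "shifted_qpoch x q 0 = 1"
  by (simp add: shifted_qpoch_def)

lemma shifted_qpoch_Suc: "shifted_qpoch x q (Suc n) = shifted_qpoch x q n * (1 - x * q ^ n)"
  by (simp add: shifted_qpoch_def)

lemma shifted_qpoch_Suc_left: "shifted_qpoch x q (Suc n) = (1 - x) * shifted_qpoch (x * q) q n"
  by (simp add: shifted_qpoch_def prod.lessThan_Suc_shift mult_ac del: prod.lessThan_Suc)

lemma norm_mult_power_less_1: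
  fixes x q :: complex
  assumes "norm q < 1" "norm x < 1"
  shows "norm (x * q ^ n) < 1"
proof -
  have "norm (x * q ^ n) = norm x * norm q ^ n"
    by (simp add: norm_mult norm_power)
  also have "\<dots> \<le> norm x * 1"
    using assms by (intro mult_left_mono power_le_one) auto
  finally show ?thesis
    using assms by simp
qed

lemma norm_square_less_1: "norm (p :: complex) < 1 \<Longrightarrow> norm (p ^ 2) < 1"
  by (simp add: norm_power power_less_one_iff)

lemma one_minus_mult_power_neq_0:
  fixes x q :: complex
  assumes "norm q < 1" "norm x < 1"
  shows "1 - x * q ^ n \<noteq> 0"
  using norm_mult_power_less_1[OF assms, of n] by auto

lemma one_minus_power_neq_0:
  fixes q :: complex
  assumes "norm q < 1" "n > 0"
  shows "1 - q ^ n \<noteq> 0"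
  using one_minus_mult_power_neq_0[OF assms(1) assms(1), of "n - 1"] assms(2)
  by (simp flip: power_Suc)

lemma qpoch_neq_0: "norm q < 1 \<Longrightarrow> qpoch q n \<noteq> 0"
  using one_minus_mult_power_neq_0[of q q] by (simp add: qpoch_def)

lemma Suc_Suc_choose_two: "Suc (Suc n) choose 2 = (Suc n choose 2) + Suc n"
  by (simp add: numeral_2_eq_2)

text \<open>Induction on n: in summand k, split 1 - q^(n+1) as (1 - q^(n+1-k)) + q^(n+1-k) (1 -
  q^k). The first part lowers \<open>qpoch q (Suc n - k)\<close> and gives the sum for n at x. The
  second lowers \<open>qpoch q k\<close> and, after a shift of k, gives the sum for n at x q; hence
  \<open>arbitrary: x\<close>.\<close>

lemma partial_fractions:
  fixes x q :: complex
  assumes q: "norm q < 1" and x: "norm x < 1"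
  shows "(\<Sum>k\<le>n. (-1) ^ k * q ^ (Suc k choose 2) / (qpoch q (n - k) * qpoch q k * (1 - x * q ^ k)))
          = 1 / shifted_qpoch x q (Suc n)"
  using x
proof (induction n arbitrary: x)
  case 0
  then show ?case by (simp add: shifted_qpoch_def numeral_2_eq_2)
next
  case (Suc n)
  define F where "F = (\<lambda>n x. (\<Sum>k\<le>n. (-1) ^ k * q ^ (Suc k choose 2) /
                     (qpoch q (n - k) * qpoch q k * (1 - x * q ^ k))))"
  define a where "a = (\<lambda>k. (-1) ^ k * q ^ (Suc k choose 2) /
                     (qpoch q (Suc n - k) * qpoch q k * (1 - x * q ^ k)))"
  have nz: "1 - q ^ Suc m \<noteq> 0" "qpoch q m \<noteq> 0" "1 - x * q ^ m \<noteq> 0" for m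
    using one_minus_power_neq_0[OF q, of "Suc m"] qpoch_neq_0[OF q]
      one_minus_mult_power_neq_0[OF q Suc.prems] by blast+
  have "(\<Sum>k\<le>Suc n. a k * (1 - q ^ (Suc n - k))) = (\<Sum>k\<le>n. a k * (1 - q ^ (Suc n - k)))"
    by simp
  also have "\<dots> = F n x"
    unfolding F_def
  proof (intro sum.cong refl)
    fix k assume "k \<in> {..n}"
    then have "Suc n - k = Suc (n - k)" by auto
    then show "a k * (1 - q ^ (Suc n - k)) = (- 1) ^ k * q ^ (Suc k choose 2) / (qpoch q (n - k)
        * qpoch q k * (1 - x * q ^ k))"
      using nz(1)[of "n - k"] by (simp add: a_def qpoch_Suc)
  qed
  finally have 1: "(\<Sum>k\<le>Suc n. a k * (1 - q ^ (Suc n - k))) = F n x" .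
  have "(\<Sum>k\<le>Suc n. a k * (q ^ (Suc n - k) * (1 - q ^ k)))
      = (\<Sum>k\<le>n. a (Suc k) * (q ^ (n - k) * (1 - q ^ Suc k)))"
    by (simp add: sum.atMost_Suc_shift del: sum.atMost_Suc power_Suc)
  also have "\<dots> = (\<Sum>k\<le>n. - (q ^ Suc n) * ((- 1) ^ k * q ^ (Suc k choose 2) / (qpoch q (n - k) * qpoch q k
      * (1 - (x * q) * q ^ k))))"
  proof (intro sum.cong refl)
    fix k assume "k \<in> {..n}"
    then have "q ^ n = q ^ k * q ^ (n - k)" by (simp flip: power_add)
    then show "a (Suc k) * (q ^ (n - k) * (1 - q ^ Suc k))
        = - (q ^ Suc n) * ((- 1) ^ k * q ^ (Suc k choose 2) / (qpoch q (n - k) * qpoch q k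
        * (1 - (x * q) * q ^ k)))"
      using nz(1)[of k] nz(2)[of k] nz(2)[of "n - k"] nz(3)[of "Suc k"]
      by (simp add: a_def qpoch_Suc Suc_Suc_choose_two power_add divide_simps mult_ac)
  qed
  also have "\<dots> = - (q ^ Suc n) * F n (x * q)"
    by (simp only: F_def sum_distrib_left)
  finally have 2: "(\<Sum>k\<le>Suc n. a k * (q ^ (Suc n - k) * (1 - q ^ k))) = - (q ^ Suc n) * F n (x * q)" .
  have "(1 - q ^ Suc n) * F (Suc n) x = (\<Sum>k\<le>Suc n. a k * (1 - q ^ Suc n))"
    by (simp only: F_def a_def sum_distrib_left mult_ac)
  also have "\<dots> = (\<Sum>k\<le>Suc n. a k * (1 - q ^ (Suc n - k)) + a k * (q ^ (Suc n - k) * (1 - q ^ k)))"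
  proof (intro sum.cong refl)
    fix k assume "k \<in> {..Suc n}"
    then have "q ^ Suc n = q ^ (Suc n - k) * q ^ k" by (simp only: flip: power_add) simp
    then show "a k * (1 - q ^ Suc n) = a k * (1 - q ^ (Suc n - k)) + a k * (q ^ (Suc n - k) * (1 - q ^ k))"
      by (simp only: right_diff_distrib mult_1_right) simp
  qed
  also have "\<dots> = F n x - q ^ Suc n * F n (x * q)"
    by (simp only: sum.distrib 1 2) simp
  also have "\<dots> = 1 / shifted_qpoch x q (Suc n) - q ^ Suc n / shifted_qpoch (x * q) q (Suc n)"
    using Suc.IH[OF Suc.prems] Suc.IH[of "x * q"] norm_mult_power_less_1[OF q Suc.prems, of 1]
    by (simp add: F_def)
  \<comment> \<open>The product of n + 2 factors is a common denominator: dropping its last factor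
    leaves one denominator, dropping its first leaves the other.\<close>
  also have "\<dots> = (1 - q ^ Suc n) * (1 / shifted_qpoch x q (Suc (Suc n)))"
  proof -
    have e: "shifted_qpoch x q (Suc (Suc n)) = (1 - x) * shifted_qpoch (x * q) q (Suc n)"
      "shifted_qpoch x q (Suc (Suc n)) = shifted_qpoch x q (Suc n) * (1 - x * q ^ Suc n)"
      by (rule shifted_qpoch_Suc_left shifted_qpoch_Suc)+
    have "1 - x \<noteq> 0" using nz(3)[of 0] by simp
    then have "q ^ Suc n / shifted_qpoch (x * q) q (Suc n)
        = q ^ Suc n * (1 - x) / shifted_qpoch x q (Suc (Suc n))"
      unfolding e(1) by simp
    moreover have "1 / shifted_qpoch x q (Suc n) = (1 - x * q ^ Suc n) / shifted_qpoch x q (Suc (Suc n))"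
      unfolding e(2) using nz(3)[of "Suc n"] by simp
    ultimately have "1 / shifted_qpoch x q (Suc n) - q ^ Suc n / shifted_qpoch (x * q) q (Suc n)
        = ((1 - x * q ^ Suc n) - q ^ Suc n * (1 - x)) / shifted_qpoch x q (Suc (Suc n))"
      by (simp only: diff_divide_distrib)
    also have "(1 - x * q ^ Suc n) - q ^ Suc n * (1 - x) = 1 - q ^ Suc n"
      by (simp add: algebra_simps)
    finally show ?thesis by simp
  qed
  finally show ?case
    using nz(1)[of n] unfolding F_def by (simp only: mult_cancel_left) simp
qed

text \<open>By the q-binomial theorem, \<open>qpoch q n\<close> times the sum is (1;q)_n, whose
  first factor is zero. The proof is direct: the partial sum up to m has a closed form with the
  factor 1 - q^(n-m).\<close>

lemma q_binomial_at_one: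
  assumes q: "norm q < 1" and n: "n > 0"
  shows "(\<Sum>k\<le>n. (-1) ^ k * q ^ (k choose 2) / (qpoch q (n - k) * qpoch q k)) = 0"
proof -
  define a where "a = (\<lambda>k. (-1) ^ k * q ^ (k choose 2) / (qpoch q (n - k) * qpoch q k))"
  have partial: "(\<Sum>k\<le>m. a k) = a m * (1 - q ^ (n - m)) * q ^ m / (1 - q ^ n)" if "m \<le> n" for m
    using that
  proof (induction m)
    case 0
    then show ?case using one_minus_power_neq_0[OF q n] by (simp add: a_def)
  next
    case (Suc m)
    then obtain j where j: "n = Suc (m + j)"
      using less_iff_Suc_add[of m n] by auto
    have nz: "1 - q ^ Suc i \<noteq> 0" "qpoch q i \<noteq> 0" for i
      using one_minus_power_neq_0[OF q, of "Suc i"] qpoch_neq_0[OF q] by blast+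
    have "a m * (1 - q ^ Suc j) * q ^ m = - a (Suc m) * (1 - q ^ Suc m)"
      using nz(1)[of m] nz(1)[of j] nz(2)[of m] nz(2)[of j]
      by (simp add: a_def j qpoch_Suc Suc_diff_le numeral_2_eq_2 power_add divide_simps)
    moreover have "n - m = Suc j" using j by simp
    moreover have "(\<Sum>k\<le>Suc m. a k) = a m * (1 - q ^ (n - m)) * q ^ m / (1 - q ^ n) + a (Suc m)"
      using Suc by simp
    ultimately have "(\<Sum>k\<le>Suc m. a k) = - a (Suc m) * (1 - q ^ Suc m) / (1 - q ^ n) + a (Suc m)"
      by metis
    also have "\<dots> = a (Suc m) * (1 - (1 - q ^ Suc m) / (1 - q ^ n))"
      by (simp add: algebra_simps diff_divide_distrib)
    also have "1 - (1 - q ^ Suc m) / (1 - q ^ n) = (q ^ Suc m - q ^ n) / (1 - q ^ n)"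
      using one_minus_power_neq_0[OF q n] by (simp add: divide_simps)
    also have "q ^ Suc m - q ^ n = (1 - q ^ (n - Suc m)) * q ^ Suc m"
      by (simp add: j algebra_simps power_add)
    finally show ?case by simp
  qed
  show ?thesis using partial[of n] by (simp add: a_def)
qed

section \<open>Two Bailey pairs\<close>

lemma two_times_choose_two: "2 * (Suc n choose 2) = n * (n + 1)"
  by (induction n) (simp_all add: Suc_Suc_choose_two numeral_2_eq_2 algebra_simps)

lemma power_square_choose_two: "(p ^ 2) ^ (Suc n choose 2) = (p :: 'a :: monoid_mult) ^ (n ^ 2 + n)"
  by (simp only: power_mult[symmetric] two_times_choose_two) (simp add: power2_eq_square algebra_simps)

lemma choose_two_double: "Suc (2 * n) choose 2 = 2 * n ^ 2 + n"
  using two_times_choose_two[of "2 * n"] by (simp add: power2_eq_square algebra_simps)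

lemma choose_two_double_Suc: "Suc (Suc (2 * n)) choose 2 = 2 * n ^ 2 + 3 * n + 1"
  by (simp add: Suc_Suc_choose_two choose_two_double)

text \<open>For identities between monomials in p: products are merged into a single power, and only
  the exponents remain to be compared.\<close>

lemmas power_collect = power_mult[symmetric] power_add[symmetric]
  power_Suc[symmetric] power_Suc2[symmetric]

text \<open>Summation by parts: \<open>S M\<close> is the closed form of the partial sums of \<open>(B r - B (r - 1)) * R r\<close>.\<close>

lemma sum_mult_telescope_eq_0:
  fixes B c E R S :: "nat \<Rightarrow> 'a :: comm_ring"
  assumes "\<And>r. r \<le> N \<Longrightarrow> c r * E r = R r - R (Suc r)"
    and "S 0 = B 0 * R 0"
    and "\<And>r. r < N \<Longrightarrow> S (Suc r) - S r = (B (Suc r) - B r) * R (Suc r)"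
    and "S N = 0" "R (Suc N) = 0"
  shows "(\<Sum>r\<le>N. c r * B r * E r) = 0"
proof -
  have "(\<Sum>r\<le>M. c r * B r * E r) = S M - B M * R (Suc M)" if "M \<le> N" for M
    using that
  proof (induction M)
    case 0
    have "c 0 * B 0 * E 0 = B 0 * (c 0 * E 0)" by (simp add: mult_ac)
    then show ?case using assms(1)[of 0] assms(2) by (simp add: right_diff_distrib)
  next
    case (Suc M)
    have "c (Suc M) * B (Suc M) * E (Suc M) = B (Suc M) * (c (Suc M) * E (Suc M))" by (simp add: mult_ac)
    also have "\<dots> = B (Suc M) * (R (Suc M) - R (Suc (Suc M)))" using assms(1)[OF Suc.prems] by simp
    finally have "(\<Sum>r\<le>Suc M. c r * B r * E r) = S M - B M * R (Suc M) + B (Suc M)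
        * (R (Suc M) - R (Suc (Suc M)))"
      using Suc by simp
    moreover have "S M = S (Suc M) - (B (Suc M) - B M) * R (Suc M)"
      using assms(3)[of M] Suc.prems by (simp add: algebra_simps)
    ultimately show ?case by (simp add: algebra_simps)
  qed
  from this[of N] show ?thesis using assms by simp
qed

context
  fixes p :: complex and P :: "nat \<Rightarrow> complex"
  assumes p: "norm p < 1" "p \<noteq> 0"
  defines "P \<equiv> qpoch (p ^ 2)"
begin

lemma qpoch_square_neq_0: "P k \<noteq> 0"
  unfolding P_def by (rule qpoch_neq_0[OF norm_square_less_1[OF p(1)]])

lemma qpoch_square_Suc: "P (Suc k) = P k * (1 - p ^ (2 * k + 2))"
  by (simp only: P_def qpoch_Suc power_mult[symmetric]) simp

text \<open>
  The claimed Bailey pair satisfies the recurrence \<open>\<beta>\<^sub>N (1 - p\<^bsup>2N+1\<^esup>) = \<beta>\<^bsub>N-1\<^esub>\<close>. In the subtracted term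
  the factor \<open>1 - p\<^bsup>2(N-r)\<^esup>\<close> shifts \<open>P (N - r)\<close> to \<open>P (N - 1 - r)\<close> and removes the
  summand \<open>r = N\<close>, where the truncated subtraction \<open>N - 1 - r\<close> would be wrong.
\<close>

lemma bailey_vanishing_even:
  assumes "N > 0"
  shows "(\<Sum>r\<le>N. (-1) ^ r * p ^ (3 * r ^ 2 + 2 * r) * (1 + p ^ (2 * r + 1)) *
           (\<Sum>i\<le>2 * r. 1 / p ^ (Suc i choose 2)) *
           ((1 - p ^ (2 * N + 1)) / (P (N - r) * P (N + r + 1))
             - (1 - p ^ (2 * (N - r))) / (P (N - r) * P (N + r)))) = 0"
proof -
  let ?c = "\<lambda>r. (-1) ^ r * p ^ (3 * r ^ 2 + 2 * r) * (1 + p ^ (2 * r + 1))"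
  let ?E = "\<lambda>r. (1 - p ^ (2 * N + 1)) / (P (N - r) * P (N + r + 1)) - (1 - p ^ (2 * (N - r)))
      / (P (N - r) * P (N + r))"
  \<comment> \<open>An antidifference of \<open>?c r * ?E r\<close>. The cut-off stands for
    1/(Q;Q)_(N-r) = 0 at r > N, where \<open>N - r\<close> would be truncated to 0.\<close>
  let ?R = "\<lambda>r. if r \<le> N then (-1) ^ r * p ^ (3 * r ^ 2 + 2 * N) / (P (N - r) * P (N + r)) else 0"
  \<comment> \<open>Here the second telescoping happens: the increments of \<open>?B\<close> times
    \<open>?R\<close> have a closed form too. Its factor \<open>1 - p ^ (2 * (N - r))\<close> makes
    it vanish at r = N.\<close>
  let ?S = "\<lambda>r. p ^ (2 * N) * (-1) ^ r * p ^ (r ^ 2 + r) * (1 - p ^ (2 * (N - r)))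
                 / ((1 - p ^ (2 * N)) * P (N - r) * P (N + r))"
  let ?B = "\<lambda>r. \<Sum>i\<le>2 * r. 1 / p ^ (Suc i choose 2)"
  show ?thesis
  proof (rule sum_mult_telescope_eq_0[where c = ?c and B = ?B and E = ?E and R = ?R and S = ?S])
    show "?c r * ?E r
        = ?R r - ?R (Suc r)" if r: "r \<le> N" for r
    proof -
      obtain j where N: "N = r + j" using le_Suc_ex[OF r] by blast
      \<comment> \<open>In these letters the claim is an identity of rational functions, which
        reduces to the polynomial identity \<open>key\<close> once \<open>s\<close>,
        \<open>A\<close>, \<open>K\<close> and the powers of \<open>W\<close> cancel.\<close>
      define u v W s A K d where "u = p ^ r" and "v = p ^ j" and "W = p ^ (r ^ 2)"
          and "s = (-1 :: complex) ^ r"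
        and "A = P j" and "K = P (N + r)" and "d = 1 - p ^ 2 * u ^ 4 * v ^ 2"
      have K: "P (N + r + 1) = K * d"
      proof -
        have "p ^ (2 * (N + r) + 2) = p ^ 2 * u ^ 4 * v ^ 2"
          by (simp only: N W_def u_def v_def power_collect, rule arg_cong[where f = "power p"],
              simp add: power2_eq_square algebra_simps)
        then show ?thesis using qpoch_square_Suc[of "N + r"] by (simp add: K_def d_def)
      qed
      have nz: "A \<noteq> 0" "K \<noteq> 0" "d \<noteq> 0"
        using qpoch_square_neq_0[of "N + r + 1"] K by (auto simp: A_def K_def qpoch_square_neq_0)
      have R: "?R (Suc r) = - s * W ^ 3 * u ^ 8 * p ^ 3 * v ^ 2 * (1 - v ^ 2) / (A * K * d)"
      \<comment> \<open>For j = 0, that is r = N, the left side is zero by the cut-off and the right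
        side by its factor \<open>1 - v ^ 2\<close>.\<close>
      proof (cases j)
        case 0
        then show ?thesis by (simp add: N v_def)
      next
        case (Suc i)
        have "A = P i * (1 - v ^ 2)"
          by (simp add: A_def Suc qpoch_square_Suc v_def mult.commute flip: power_mult power_Suc)
        moreover have "p ^ (3 * Suc r ^ 2 + 2 * N) = W ^ 3 * u ^ 8 * p ^ 3 * v ^ 2"
          by (simp only: N W_def u_def v_def power_collect, rule arg_cong[where f = "power p"],
              simp add: power2_eq_square algebra_simps)
        ultimately show ?thesis using K nz by (simp add: N Suc s_def)
      qed
      have pw: "p ^ (3 * r ^ 2 + 2 * r) = W ^ 3 * u ^ 2" "p ^ (2 * r + 1) = u ^ 2 * p"
        "p ^ (2 * N + 1) = p * u ^ 2 * v ^ 2" "p ^ (2 * (N - r)) = v ^ 2" "p ^ (3 * r ^ 2 + 2 * N)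
            = W ^ 3 * u ^ 2 * v ^ 2"
        by (simp_all only: N diff_Suc_Suc Suc_diff_le[OF le_add1] diff_add_inverse W_def u_def v_def
            power_collect)
          (rule arg_cong[where f = "power p"], simp add: power2_eq_square algebra_simps)+
      have key: "(1 + u ^ 2 * p) * ((1 - p * u ^ 2 * v ^ 2) - (1 - v ^ 2) * d) = v ^ 2 * d + u ^ 6 * p ^ 3
          * v ^ 2 * (1 - v ^ 2)"
        unfolding d_def by (simp add: algebra_simps eval_nat_numeral)
      have "s * (W ^ 3 * u ^ 2) * (1 + u ^ 2 * p) * ((1 - p * u ^ 2 * v ^ 2) / (A * (K * d)) - (1 - v ^ 2)
          / (A * K))
        = s * W ^ 3 * u ^ 2 * ((1 + u ^ 2 * p) * ((1 - p * u ^ 2 * v ^ 2) - (1 - v ^ 2) * d)) / (A * K * d)"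
        using nz by (simp add: divide_simps)
      also have "\<dots> = s * (W ^ 3 * u ^ 2 * v ^ 2) / (A * K) - (- s * W ^ 3 * u ^ 8 * p ^ 3 * v ^ 2
          * (1 - v ^ 2) / (A * K * d))"
        unfolding key using nz by (simp add: divide_simps) (simp add: algebra_simps eval_nat_numeral)
      finally have "s * (W ^ 3 * u ^ 2) * (1 + u ^ 2 * p) * ((1 - p * u ^ 2 * v ^ 2) / (A * (K * d))
          - (1 - v ^ 2) / (A * K))
        = s * (W ^ 3 * u ^ 2 * v ^ 2) / (A * K) - ?R (Suc r)" unfolding R .
      moreover have "N - r = j" "r \<le> N" using N by auto
      ultimately show ?thesis unfolding pw K by (simp add: s_def A_def K_def)
    qed
    show "?S 0 = ?B 0 * ?R 0"
      using one_minus_power_neq_0[OF p(1), of "2 * N"] assms by (simp add: numeral_2_eq_2)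
    show "?S (Suc r) - ?S r = (?B (Suc r) - ?B r) * ?R (Suc r)" if r: "r < N" for r
    proof -
      obtain j where N: "N = Suc (r + j)" using r less_iff_Suc_add[of r N] by auto
      define u v W s A K d d1 e where "u = p ^ r" and "v = p ^ j" and "W = p ^ (r ^ 2)"
          and "s = (-1 :: complex) ^ r"
        and "A = P j" and "K = P (N + r)" and "d = 1 - p ^ 4 * u ^ 4 * v ^ 2" and "d1 = 1 - p ^ 2 * v ^ 2"
        and "e = 1 - p ^ 2 * u ^ 2 * v ^ 2"
      have K: "P (N + Suc r) = K * d"
      proof -
        have "p ^ (2 * (N + r) + 2) = p ^ 4 * u ^ 4 * v ^ 2"
          by (simp only: N W_def u_def v_def power_collect, rule arg_cong[where f = "power p"],
              simp add: power2_eq_square algebra_simps)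
        then show ?thesis using qpoch_square_Suc[of "N + r"] by (simp add: K_def d_def)
      qed
      have A: "P (N - r) = A * d1"
      proof -
        have "p ^ (2 * j + 2) = p ^ 2 * v ^ 2"
          by (simp only: N W_def u_def v_def power_collect, rule arg_cong[where f = "power p"],
              simp add: power2_eq_square algebra_simps)
        then show ?thesis using qpoch_square_Suc[of j] by (simp add: A_def d1_def N)
      qed
      have e: "1 - p ^ (2 * N) = e"
      proof -
        have "p ^ (2 * N) = p ^ 2 * u ^ 2 * v ^ 2"
          by (simp only: N W_def u_def v_def power_collect, rule arg_cong[where f = "power p"],
              simp add: power2_eq_square algebra_simps)
        then show ?thesis by (simp add: e_def)
      qed
      have nz: "A \<noteq> 0" "K \<noteq> 0" "d \<noteq> 0" "d1 \<noteq> 0" "e \<noteq> 0" "u \<noteq> 0" "W \<noteq> 0" "p \<noteq> 0"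
        using qpoch_square_neq_0[of "N + Suc r"] qpoch_square_neq_0[of "N - r"] K A
            one_minus_power_neq_0[OF p(1), of "2 * N"] assms p
        by (auto simp: e u_def W_def)
      \<comment> \<open>The new theta terms have the indices i = 2r + 1 and i = 2r + 2. They combine
        into 1 + p^2 u^2, which is the cofactor of \<open>e\<close> in \<open>key\<close>
        below.\<close>
      have B: "?B (Suc r) - ?B r = (1 + p ^ 2 * u ^ 2) / (W ^ 2 * u ^ 5 * p ^ 3)"
      proof -
        have "?B (Suc r) - ?B r = 1 / p ^ (2 * r ^ 2 + 3 * r + 1) + 1 / p ^ (2 * Suc r ^ 2 + Suc r)"
          using choose_two_double_Suc[of r] choose_two_double[of "Suc r"] by simp
        also have "p ^ (2 * r ^ 2 + 3 * r + 1) = W ^ 2 * u ^ 3 * p"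
          by (simp only: N W_def u_def v_def power_collect, rule arg_cong[where f = "power p"],
              simp add: power2_eq_square algebra_simps)
        also have "p ^ (2 * Suc r ^ 2 + Suc r) = W ^ 2 * u ^ 5 * p ^ 3"
          by (simp only: N W_def u_def v_def power_collect, rule arg_cong[where f = "power p"],
              simp add: power2_eq_square algebra_simps)
        also have "1 / (W ^ 2 * u ^ 3 * p) + 1 / (W ^ 2 * u ^ 5 * p ^ 3)
            = (1 + p ^ 2 * u ^ 2) / (W ^ 2 * u ^ 5 * p ^ 3)"
          using nz by (simp add: divide_simps power_numeral_reduce)
        finally show ?thesis .
      qed
      have pw: "p ^ (2 * N) = p ^ 2 * u ^ 2 * v ^ 2" "p ^ (Suc r ^ 2 + Suc r) = W * u ^ 3 * p ^ 2"
          "p ^ (r ^ 2 + r) = W * u"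
         "p ^ (2 * (N - Suc r)) = v ^ 2" "p ^ (2 * (N - r)) = p ^ 2 * v ^ 2"
         "p ^ (3 * Suc r ^ 2 + 2 * N) = W ^ 3 * u ^ 8 * p ^ 5 * v ^ 2"
        by (simp_all only: N diff_Suc_Suc Suc_diff_le[OF le_add1] diff_add_inverse W_def u_def v_def
            power_collect)
          (rule arg_cong[where f = "power p"], simp add: power2_eq_square algebra_simps)+
      have S0: "?S r = s * p ^ 2 * u ^ 3 * v ^ 2 * W / (e * A * K)"
        unfolding pw e[unfolded pw] A using nz
            by (simp add: s_def K_def d1_def field_simps power_numeral_reduce)
      have S1: "?S (Suc r) = - s * p ^ 4 * u ^ 5 * v ^ 2 * W * (1 - v ^ 2) / (e * A * K * d)"
        unfolding pw e[unfolded pw] K using nz by (simp add: N s_def A_def field_simps power_numeral_reduce)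
      have R: "?R (Suc r) = - s * W ^ 3 * u ^ 8 * p ^ 5 * v ^ 2 / (A * K * d)"
        unfolding pw K using nz by (simp add: N s_def A_def mult_ac)
      have key: "- (p ^ 2 * u ^ 2 * (1 - v ^ 2)) - d = - (1 + p ^ 2 * u ^ 2) * e"
        unfolding d_def e_def by (simp add: algebra_simps eval_nat_numeral)
      have "?S (Suc r) - ?S r = s * p ^ 2 * u ^ 3 * v ^ 2 * W * (- (p ^ 2 * u ^ 2 * (1 - v ^ 2)) - d)
          / (e * A * K * d)"
        unfolding S0 S1 using nz by (simp add: divide_simps) (simp add: algebra_simps eval_nat_numeral)
      also have "\<dots> = (1 + p ^ 2 * u ^ 2) / (W ^ 2 * u ^ 5 * p ^ 3) * ?R (Suc r)"
        unfolding key R using nz by (simp add: divide_simps) (simp add: algebra_simps eval_nat_numeral)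
      finally show ?thesis unfolding B .
    qed
  qed simp_all
qed

text \<open>With Q = p^2, this is a Bailey pair relative to a = Q: \<open>P (n + r + 1)\<close> is
  (aQ;Q)_(n+r) up to the constant 1 - Q. Passing from n to n + 1 divides the right side by 1 -
  p^(2n+3), and \<open>bailey_vanishing_even\<close> says the same of the left side.\<close>

lemma bailey_pair_even:
  "(\<Sum>r\<le>n. (-1) ^ r * p ^ (3 * r ^ 2 + 2 * r) * (1 + p ^ (2 * r + 1)) *
            (\<Sum>i\<le>2 * r. 1 / p ^ (Suc i choose 2)) / (P (n - r) * P (n + r + 1)))
         = 1 / shifted_qpoch p (p ^ 2) (Suc n)"
proof (induction n)
  case 0
  have "1 - p \<noteq> 0" "1 + p \<noteq> 0" "1 - p * p \<noteq> 0"
    using p(1) one_minus_power_neq_0[OF p(1), of 2] by (auto simp: add_eq_0_iff power2_eq_square)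
  then show ?case
    by (simp add: P_def qpoch_Suc shifted_qpoch_Suc numeral_2_eq_2 divide_simps) (simp add: algebra_simps)
next
  case (Suc n)
  define a where "a = (\<lambda>r. (-1) ^ r * p ^ (3 * r ^ 2 + 2 * r) * (1 + p ^ (2 * r + 1))
      * (\<Sum>i\<le>2 * r. 1 / p ^ (Suc i choose 2)))"
  define N where "N = Suc n"
  have nz: "1 - p ^ (2 * N + 1) \<noteq> 0" by (intro one_minus_power_neq_0[OF p(1)]) simp
  have "(\<Sum>r\<le>N. a r * ((1 - p ^ (2 * N + 1)) / (P (N - r) * P (N + r + 1)))) =
        (\<Sum>r\<le>N. a r * ((1 - p ^ (2 * (N - r))) / (P (N - r) * P (N + r))))"
    using bailey_vanishing_even[of N] unfolding a_def right_diff_distrib sum_subtractf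
        by (simp add: N_def del: sum.atMost_Suc power_Suc)
  also have "\<dots> = (\<Sum>r\<le>n. a r * ((1 - p ^ (2 * (N - r))) / (P (N - r) * P (N + r))))"
    by (simp add: N_def)
  also have "\<dots> = (\<Sum>r\<le>n. a r / (P (n - r) * P (n + r + 1)))"
  proof (intro sum.cong refl)
    fix r assume "r \<in> {..n}"
    then have "N - r = Suc (n - r)" "N + r = n + r + 1" by (auto simp: N_def)
    moreover have "1 - p ^ (2 * (n - r) + 2) \<noteq> 0" by (intro one_minus_power_neq_0[OF p(1)]) simp
    ultimately show "a r * ((1 - p ^ (2 * (N - r))) / (P (N - r) * P (N + r)))
        = a r / (P (n - r) * P (n + r + 1))"
      by (simp add: qpoch_square_Suc)
  qed
  also have "\<dots> = 1 / shifted_qpoch p (p ^ 2) (Suc n)"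
    using Suc.IH by (simp only: a_def)
  finally have "(1 - p ^ (2 * N + 1)) * (\<Sum>r\<le>N. a r / (P (N - r) * P (N + r + 1)))
      = (1 - p ^ (2 * N + 1)) * (1 / (shifted_qpoch p (p ^ 2) (Suc n) * (1 - p ^ (2 * N + 1))))"
    using nz by (simp add: sum_distrib_left mult_ac)
  then have "(\<Sum>r\<le>N. a r / (P (N - r) * P (N + r + 1)))
      = 1 / (shifted_qpoch p (p ^ 2) (Suc n) * (1 - p ^ (2 * N + 1)))"
    using nz by (simp only: mult_cancel_left) simp
  also have "1 - p ^ (2 * N + 1) = 1 - p * (p ^ 2) ^ Suc n"
    by (simp only: N_def power_mult[symmetric] power_add) simp
  also have "shifted_qpoch p (p ^ 2) (Suc n) * (1 - p * (p ^ 2) ^ Suc n) = shifted_qpoch p (p ^ 2) (Suc N)"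
    by (simp only: shifted_qpoch_Suc N_def)
  finally show ?case by (simp only: a_def N_def)
qed

text \<open>The counterpart of \<open>bailey_vanishing_even\<close> relative to a = Q^2. The factor
  1 - p^(4r+4) is the usual 1 - a Q^(2r) of a Bailey pair. The two closed forms acquire the extra
  factors \<open>1 - p ^ (2 * r + 1)\<close> in \<open>?R\<close> and
  \<open>1 - p ^ (2 * r + 2)\<close> in \<open>?S\<close>; the method is unchanged.\<close>

lemma bailey_vanishing_odd:
  assumes "N > 0"
  shows "(\<Sum>r\<le>N. (-1) ^ r * p ^ (3 * r ^ 2 + 4 * r + 1) * (1 - p ^ (4 * r + 4)) *
           (\<Sum>i\<le>2 * r + 1. 1 / p ^ (Suc i choose 2)) *
           ((1 - p ^ (2 * N + 1)) / (P (N - r) * P (N + r + 2))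
             - (1 - p ^ (2 * (N - r))) / (P (N - r) * P (N + r + 1)))) = 0"
proof -
  let ?c = "\<lambda>r. (-1) ^ r * p ^ (3 * r ^ 2 + 4 * r + 1) * (1 - p ^ (4 * r + 4))"
  let ?E = "\<lambda>r. (1 - p ^ (2 * N + 1)) / (P (N - r) * P (N + r + 2)) - (1 - p ^ (2 * (N - r)))
      / (P (N - r) * P (N + r + 1))"
  let ?R = "\<lambda>r. if r \<le> N then (-1) ^ r * p ^ (3 * r ^ 2 + 2 * r + 1 + 2 * N) * (1 - p ^ (2 * r + 1))
      / (P (N - r) * P (N + r + 1)) else 0"
  let ?S = "\<lambda>r. p ^ (2 * N) * (-1) ^ r * p ^ (r ^ 2 + r) * (1 - p ^ (2 * r + 2)) * (1 - p ^ (2 * (N - r)))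
                 / ((1 - p ^ (2 * N)) * P (N - r) * P (N + r + 1))"
  let ?B = "\<lambda>r. \<Sum>i\<le>2 * r + 1. 1 / p ^ (Suc i choose 2)"
  show ?thesis
  proof (rule sum_mult_telescope_eq_0[where c = ?c and B = ?B and E = ?E and R = ?R and S = ?S])
    show "?c r * ?E r
        = ?R r - ?R (Suc r)" if r: "r \<le> N" for r
    proof -
      obtain j where N: "N = r + j" using le_Suc_ex[OF r] by blast
      define u v W s A K d where "u = p ^ r" and "v = p ^ j" and "W = p ^ (r ^ 2)"
          and "s = (-1 :: complex) ^ r"
        and "A = P j" and "K = P (N + r + 1)" and "d = 1 - p ^ 4 * u ^ 4 * v ^ 2"
      have K: "P (N + r + 2) = K * d"
      proof -
        have "p ^ (2 * (N + r + 1) + 2) = p ^ 4 * u ^ 4 * v ^ 2"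
          by (simp only: N W_def u_def v_def power_collect, rule arg_cong[where f = "power p"],
              simp add: power2_eq_square algebra_simps)
        then show ?thesis using qpoch_square_Suc[of "N + r + 1"] by (simp add: K_def d_def)
      qed
      have nz: "A \<noteq> 0" "K \<noteq> 0" "d \<noteq> 0"
        using qpoch_square_neq_0[of "N + r + 2"] K by (auto simp: A_def K_def qpoch_square_neq_0)
      have R: "?R (Suc r) = - s * W ^ 3 * u ^ 10 * p ^ 6 * v ^ 2 * (1 - u ^ 2 * p ^ 3) * (1 - v ^ 2)
          / (A * K * d)"
      proof (cases j)
        case 0
        then show ?thesis by (simp add: N v_def)
      next
        case (Suc i)
        have "A = P i * (1 - v ^ 2)"
          by (simp add: A_def Suc qpoch_square_Suc v_def mult.commute flip: power_mult power_Suc)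
        moreover have "p ^ (2 * Suc r + 1) = u ^ 2 * p ^ 3"
          by (simp only: N W_def u_def v_def power_collect, rule arg_cong[where f = "power p"],
              simp add: power2_eq_square algebra_simps)
        moreover have "p ^ (3 * Suc r ^ 2 + 2 * Suc r + 1 + 2 * N) = W ^ 3 * u ^ 10 * p ^ 6 * v ^ 2"
          by (simp only: N W_def u_def v_def power_collect, rule arg_cong[where f = "power p"],
              simp add: power2_eq_square algebra_simps)
        ultimately show ?thesis using K nz
            by (simp add: N Suc s_def del: power_Suc mult_Suc_right) (simp add: mult_ac)
      qed
      have pw: "p ^ (3 * r ^ 2 + 4 * r + 1) = W ^ 3 * u ^ 4 * p" "p ^ (4 * r + 4) = u ^ 4 * p ^ 4"
          "p ^ (2 * r + 1) = u ^ 2 * p"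
        "p ^ (2 * N + 1) = p * u ^ 2 * v ^ 2" "p ^ (2 * (N - r))
            = v ^ 2" "p ^ (3 * r ^ 2 + 2 * r + 1 + 2 * N) = W ^ 3 * u ^ 4 * p * v ^ 2"
        by (simp_all only: N diff_Suc_Suc Suc_diff_le[OF le_add1] diff_add_inverse W_def u_def v_def
            power_collect)
          (rule arg_cong[where f = "power p"], simp add: power2_eq_square algebra_simps)+
      have key: "(1 - u ^ 4 * p ^ 4) * ((1 - p * u ^ 2 * v ^ 2) - (1 - v ^ 2) * d)
        = v ^ 2 * (1 - u ^ 2 * p) * d + u ^ 6 * p ^ 5 * v ^ 2 * (1 - u ^ 2 * p ^ 3) * (1 - v ^ 2)"
        unfolding d_def by (simp add: algebra_simps eval_nat_numeral)
      have "s * (W ^ 3 * u ^ 4 * p) * (1 - u ^ 4 * p ^ 4) * ((1 - p * u ^ 2 * v ^ 2) / (A * (K * d))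
          - (1 - v ^ 2) / (A * K))
        = s * W ^ 3 * u ^ 4 * p * ((1 - u ^ 4 * p ^ 4) * ((1 - p * u ^ 2 * v ^ 2) - (1 - v ^ 2) * d))
            / (A * K * d)"
        using nz by (simp add: divide_simps)
      also have "\<dots> = s * (W ^ 3 * u ^ 4 * p * v ^ 2) * (1 - u ^ 2 * p) / (A * K)
          - (- s * W ^ 3 * u ^ 10 * p ^ 6 * v ^ 2 * (1 - u ^ 2 * p ^ 3) * (1 - v ^ 2) / (A * K * d))"
        unfolding key using nz by (simp add: divide_simps) (simp add: algebra_simps eval_nat_numeral)
      finally have "s * (W ^ 3 * u ^ 4 * p) * (1 - u ^ 4 * p ^ 4)
          * ((1 - p * u ^ 2 * v ^ 2) / (A * (K * d)) - (1 - v ^ 2) / (A * K))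
        = s * (W ^ 3 * u ^ 4 * p * v ^ 2) * (1 - u ^ 2 * p) / (A * K) - ?R (Suc r)" unfolding R .
      moreover have "N - r = j" "r \<le> N" using N by auto
      ultimately show ?thesis unfolding pw K by (simp add: s_def A_def K_def)
    qed
    show "?S 0 = ?B 0 * ?R 0"
    proof -
      have nz: "1 - p ^ (2 * N) \<noteq> 0" "P N \<noteq> 0" "P (N + 1) \<noteq> 0"
        using one_minus_power_neq_0[OF p(1), of "2 * N"] assms qpoch_square_neq_0 by auto
      have "?S 0 = p ^ (2 * N) * (1 - p ^ 2) / (P N * P (N + 1))"
        using nz(1) by (simp add: power2_eq_square)
      also have "\<dots> = (1 + 1 / p) * (p * p ^ (2 * N) * (1 - p) / (P N * P (N + 1)))"
        using nz(2,3) p(2) by (simp add: divide_simps) (simp add: power2_eq_square algebra_simps)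
      also have "\<dots> = ?B 0 * ?R 0"
        by (simp add: numeral_2_eq_2)
      finally show ?thesis .
    qed
    show "?S (Suc r) - ?S r = (?B (Suc r) - ?B r) * ?R (Suc r)" if r: "r < N" for r
    proof -
      obtain j where N: "N = Suc (r + j)" using r less_iff_Suc_add[of r N] by auto
      define u v W s A K d d1 e where "u = p ^ r" and "v = p ^ j" and "W = p ^ (r ^ 2)"
          and "s = (-1 :: complex) ^ r"
        and "A = P j" and "K = P (N + r + 1)" and "d = 1 - p ^ 6 * u ^ 4 * v ^ 2"
            and "d1 = 1 - p ^ 2 * v ^ 2"
        and "e = 1 - p ^ 2 * u ^ 2 * v ^ 2"
      have K: "P (N + Suc r + 1) = K * d"
      proof -
        have "p ^ (2 * (N + r + 1) + 2) = p ^ 6 * u ^ 4 * v ^ 2"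
          by (simp only: N W_def u_def v_def power_collect, rule arg_cong[where f = "power p"],
              simp add: power2_eq_square algebra_simps)
        then show ?thesis using qpoch_square_Suc[of "N + r + 1"] by (simp add: K_def d_def)
      qed
      have A: "P (N - r) = A * d1"
      proof -
        have "p ^ (2 * j + 2) = p ^ 2 * v ^ 2"
          by (simp only: N W_def u_def v_def power_collect, rule arg_cong[where f = "power p"],
              simp add: power2_eq_square algebra_simps)
        then show ?thesis using qpoch_square_Suc[of j] by (simp add: A_def d1_def N)
      qed
      have e: "1 - p ^ (2 * N) = e"
      proof -
        have "p ^ (2 * N) = p ^ 2 * u ^ 2 * v ^ 2"
          by (simp only: N W_def u_def v_def power_collect, rule arg_cong[where f = "power p"],
              simp add: power2_eq_square algebra_simps)
        then show ?thesis by (simp add: e_def)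
      qed
      have nz: "A \<noteq> 0" "K \<noteq> 0" "d \<noteq> 0" "d1 \<noteq> 0" "e \<noteq> 0" "u \<noteq> 0" "W \<noteq> 0" "p \<noteq> 0"
        using qpoch_square_neq_0[of "N + Suc r + 1"] qpoch_square_neq_0[of "N - r"] K A
            one_minus_power_neq_0[OF p(1), of "2 * N"] assms p
        by (auto simp: e u_def W_def)
      have B: "?B (Suc r) - ?B r = (1 + u ^ 2 * p ^ 3) / (W ^ 2 * u ^ 7 * p ^ 6)"
      proof -
        have "?B (Suc r) - ?B r = 1 / p ^ (2 * Suc r ^ 2 + Suc r) + 1 / p ^ (2 * Suc r ^ 2 + 3 * Suc r + 1)"
          using choose_two_double_Suc[of "Suc r"] choose_two_double[of "Suc r"] by simp
        also have "p ^ (2 * Suc r ^ 2 + Suc r) = W ^ 2 * u ^ 5 * p ^ 3"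
          by (simp only: N W_def u_def v_def power_collect, rule arg_cong[where f = "power p"],
              simp add: power2_eq_square algebra_simps)
        also have "p ^ (2 * Suc r ^ 2 + 3 * Suc r + 1) = W ^ 2 * u ^ 7 * p ^ 6"
          by (simp only: N W_def u_def v_def power_collect, rule arg_cong[where f = "power p"],
              simp add: power2_eq_square algebra_simps)
        also have "1 / (W ^ 2 * u ^ 5 * p ^ 3) + 1 / (W ^ 2 * u ^ 7 * p ^ 6)
            = (1 + u ^ 2 * p ^ 3) / (W ^ 2 * u ^ 7 * p ^ 6)"
          using nz by (simp add: divide_simps power_numeral_reduce)
        finally show ?thesis .
      qed
      have pw: "p ^ (2 * N) = p ^ 2 * u ^ 2 * v ^ 2" "p ^ (Suc r ^ 2 + Suc r) = W * u ^ 3 * p ^ 2"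
          "p ^ (r ^ 2 + r) = W * u"
         "p ^ (2 * (N - Suc r)) = v ^ 2" "p ^ (2 * (N - r)) = p ^ 2 * v ^ 2"
         "p ^ (3 * Suc r ^ 2 + 2 * Suc r + 1 + 2 * N) = W ^ 3 * u ^ 10 * p ^ 8 * v ^ 2"
         "p ^ (2 * Suc r + 1) = u ^ 2 * p ^ 3" "p ^ (2 * Suc r + 2) = u ^ 2 * p ^ 4" "p ^ (2 * r + 2)
             = u ^ 2 * p ^ 2"
        by (simp_all only: N diff_Suc_Suc Suc_diff_le[OF le_add1] diff_add_inverse W_def u_def v_def
            power_collect)
          (rule arg_cong[where f = "power p"], simp add: power2_eq_square algebra_simps)+
      have S0: "?S r = s * p ^ 2 * u ^ 3 * v ^ 2 * W * (1 - u ^ 2 * p ^ 2) / (e * A * K)"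
        unfolding pw e[unfolded pw] A using nz
            by (simp add: s_def K_def d1_def field_simps power_numeral_reduce)
      have S1: "?S (Suc r) = - s * p ^ 4 * u ^ 5 * v ^ 2 * W * (1 - u ^ 2 * p ^ 4) * (1 - v ^ 2)
          / (e * A * K * d)"
        unfolding pw e[unfolded pw] K using nz by (simp add: N s_def A_def field_simps power_numeral_reduce)
      have R: "?R (Suc r) = - s * W ^ 3 * u ^ 10 * p ^ 8 * v ^ 2 * (1 - u ^ 2 * p ^ 3) / (A * K * d)"
        unfolding pw K using nz by (simp add: N s_def A_def mult_ac)
      have key: "- (p ^ 2 * u ^ 2 * (1 - u ^ 2 * p ^ 4) * (1 - v ^ 2)) - (1 - u ^ 2 * p ^ 2) * d
          = - (1 - u ^ 4 * p ^ 6) * e"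
        unfolding d_def e_def by (simp add: algebra_simps eval_nat_numeral)
      have "?S (Suc r) - ?S r = s * p ^ 2 * u ^ 3 * v ^ 2 * W
          * (- (p ^ 2 * u ^ 2 * (1 - u ^ 2 * p ^ 4) * (1 - v ^ 2)) - (1 - u ^ 2 * p ^ 2) * d)
          / (e * A * K * d)"
        unfolding S0 S1 using nz by (simp add: divide_simps) (simp add: algebra_simps eval_nat_numeral)
      also have "\<dots> = (1 + u ^ 2 * p ^ 3) / (W ^ 2 * u ^ 7 * p ^ 6) * ?R (Suc r)"
        unfolding key R using nz by (simp add: divide_simps) (simp add: algebra_simps eval_nat_numeral)
      finally show ?thesis unfolding B .
    qed
  qed simp_all
qed

text \<open>The beta-side is that of \<open>bailey_pair_even\<close>, but the pair is relative to a
  = Q^2: \<open>P (n + r + 2)\<close> is (aQ;Q)_(n+r) up to a constant. The recurrence in n is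
  therefore the same.\<close>

lemma bailey_pair_odd:
  "(\<Sum>r\<le>n. (-1) ^ r * p ^ (3 * r ^ 2 + 4 * r + 1) * (1 - p ^ (4 * r + 4)) *
            (\<Sum>i\<le>2 * r + 1. 1 / p ^ (Suc i choose 2)) / (P (n - r) * P (n + r + 2)))
         = 1 / shifted_qpoch p (p ^ 2) (Suc n)"
proof (induction n)
  case 0
  have "1 - p \<noteq> 0" "1 + p \<noteq> 0" "1 - p * p \<noteq> 0" "1 - p * (p * (p * p)) \<noteq> 0"
    using p(1) one_minus_power_neq_0[OF p(1), of 2] one_minus_power_neq_0[OF p(1), of 4]
    by (auto simp: add_eq_0_iff power2_eq_square eval_nat_numeral)
  then show ?case using p(2)
    by (simp add: P_def qpoch_Suc shifted_qpoch_Suc eval_nat_numeral divide_simps) (simp add: algebra_simps)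
next
  case (Suc n)
  define a where "a = (\<lambda>r. (-1) ^ r * p ^ (3 * r ^ 2 + 4 * r + 1) * (1 - p ^ (4 * r + 4))
      * (\<Sum>i\<le>2 * r + 1. 1 / p ^ (Suc i choose 2)))"
  define N where "N = Suc n"
  have nz: "1 - p ^ (2 * N + 1) \<noteq> 0" by (intro one_minus_power_neq_0[OF p(1)]) simp
  have "(\<Sum>r\<le>N. a r * ((1 - p ^ (2 * N + 1)) / (P (N - r) * P (N + r + 2)))) =
        (\<Sum>r\<le>N. a r * ((1 - p ^ (2 * (N - r))) / (P (N - r) * P (N + r + 1))))"
    using bailey_vanishing_odd[of N] unfolding a_def right_diff_distrib sum_subtractf
        by (simp add: N_def del: sum.atMost_Suc power_Suc)
  also have "\<dots> = (\<Sum>r\<le>n. a r * ((1 - p ^ (2 * (N - r))) / (P (N - r) * P (N + r + 1))))"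
    by (simp add: N_def)
  also have "\<dots> = (\<Sum>r\<le>n. a r / (P (n - r) * P (n + r + 2)))"
  proof (intro sum.cong refl)
    fix r assume "r \<in> {..n}"
    then have "N - r = Suc (n - r)" "N + r = n + r + 1" by (auto simp: N_def)
    moreover have "1 - p ^ (2 * (n - r) + 2) \<noteq> 0" by (intro one_minus_power_neq_0[OF p(1)]) simp
    ultimately show "a r * ((1 - p ^ (2 * (N - r))) / (P (N - r) * P (N + r + 1)))
        = a r / (P (n - r) * P (n + r + 2))"
      by (simp add: qpoch_square_Suc)
  qed
  also have "\<dots> = 1 / shifted_qpoch p (p ^ 2) (Suc n)"
    using Suc.IH by (simp only: a_def)
  finally have "(1 - p ^ (2 * N + 1)) * (\<Sum>r\<le>N. a r / (P (N - r) * P (N + r + 2)))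
      = (1 - p ^ (2 * N + 1)) * (1 / (shifted_qpoch p (p ^ 2) (Suc n) * (1 - p ^ (2 * N + 1))))"
    using nz by (simp add: sum_distrib_left mult_ac)
  then have "(\<Sum>r\<le>N. a r / (P (N - r) * P (N + r + 2)))
      = 1 / (shifted_qpoch p (p ^ 2) (Suc n) * (1 - p ^ (2 * N + 1)))"
    using nz by (simp only: mult_cancel_left) simp
  also have "1 - p ^ (2 * N + 1) = 1 - p * (p ^ 2) ^ Suc n"
    by (simp only: N_def power_mult[symmetric] power_add) simp
  also have "shifted_qpoch p (p ^ 2) (Suc n) * (1 - p * (p ^ 2) ^ Suc n) = shifted_qpoch p (p ^ 2) (Suc N)"
    by (simp only: shifted_qpoch_Suc N_def)
  finally show ?case by (simp only: a_def N_def)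
qed

end

section \<open>The conjugate Bailey pair\<close>

text \<open>The convergence criterion of the analytic part. Pochhammer symbols and their reciprocals
  grow at most geometrically, and a quadratic exponent beats every K, since the ratio K x^m of
  consecutive terms tends to 0.\<close>

lemma summable_power_choose_two:
  fixes K x :: real
  assumes x: "0 \<le> x" "x < 1"
  shows "summable (\<lambda>m. K ^ m * x ^ (m choose 2))"
proof -
  have "(\<lambda>m. K * x ^ m) \<longlonglongrightarrow> K * 0"
    using x by (intro tendsto_intros LIMSEQ_realpow_zero)
  then have "eventually (\<lambda>m. norm (K * x ^ m) < 1 / 2) sequentially"
    using order_tendstoD(2)[OF tendsto_norm_zero, of "\<lambda>m. K * x ^ m" sequentially "1 / 2"] by simp
  then obtain N where N: "\<And>m. m \<ge> N \<Longrightarrow> norm (K * x ^ m) < 1 / 2"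
    by (auto simp: eventually_sequentially)
  show ?thesis
  proof (rule summable_ratio_test)
    fix m assume "m \<ge> N"
    have "K ^ Suc m * x ^ (Suc m choose 2) = (K * x ^ m) * (K ^ m * x ^ (m choose 2))"
      by (simp add: numeral_2_eq_2 power_add)
    then have "norm (K ^ Suc m * x ^ (Suc m choose 2)) = norm (K * x ^ m) * norm (K ^ m * x ^ (m choose 2))"
      by (metis norm_mult)
    also have "\<dots> \<le> 1 / 2 * norm (K ^ m * x ^ (m choose 2))"
      using N[OF \<open>m \<ge> N\<close>] by (intro mult_right_mono) auto
    finally show "norm (K ^ Suc m * x ^ (Suc m choose 2)) \<le> 1 / 2 * norm (K ^ m * x ^ (m choose 2))" .
  qed simp
qed

lemma norm_qpoch_le:
  assumes "norm q < 1"
  shows "norm (qpoch q n) \<le> 2 ^ n"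
proof (induction n)
  case (Suc n)
  have "norm (1 - q ^ Suc n) \<le> 1 + norm q ^ Suc n"
    by (metis norm_one norm_power norm_triangle_ineq4)
  also have "\<dots> \<le> 2"
    using assms power_le_one[of "norm q" "Suc n"] by (simp del: power_Suc)
  finally have "norm (qpoch q n) * norm (1 - q ^ Suc n) \<le> 2 ^ n * 2"
    using Suc by (intro mult_mono) auto
  then show ?case by (simp add: qpoch_Suc norm_mult mult_ac)
qed simp

lemma norm_inverse_shifted_qpoch_le:
  assumes q: "norm q < 1" and x: "norm x < 1"
  shows "norm (1 / shifted_qpoch x q n) \<le> (1 / (1 - norm x)) ^ n"
proof (induction n)
  case (Suc n)
  have "norm (x * q ^ n) = norm x * norm q ^ n"
    by (simp add: norm_mult norm_power)
  also have "\<dots> \<le> norm x * 1"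
    using q by (intro mult_left_mono power_le_one) auto
  finally have "1 - norm x \<le> norm (1 - x * q ^ n)"
    using norm_triangle_ineq2[of 1 "x * q ^ n"] by simp
  then have "norm (1 / (1 - x * q ^ n)) \<le> 1 / (1 - norm x)"
    using x by (simp add: norm_divide divide_simps)
  then have "norm (1 / shifted_qpoch x q n) * norm (1 / (1 - x * q ^ n)) \<le> (1 / (1 - norm x)) ^ n
      * (1 / (1 - norm x))"
    using Suc x by (intro mult_mono) auto
  then show ?case by (simp add: shifted_qpoch_Suc norm_mult norm_divide mult_ac)
qed simp

lemma qpoch_eq_shifted_qpoch: "qpoch q n = shifted_qpoch q q n"
  by (simp add: qpoch_def shifted_qpoch_def)

lemma norm_inverse_qpoch_le:
  assumes "norm q < 1"
  shows "norm (1 / qpoch q n) \<le> (1 / (1 - norm q)) ^ n"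
  unfolding qpoch_eq_shifted_qpoch by (rule norm_inverse_shifted_qpoch_le[OF assms assms])

text \<open>These are the boundary terms at infinity of the telescoping sums in
  \<open>qpoch_quotient_sums\<close>: the second for r = 0, the first for the step from r to r +
  1.\<close>

lemma qpoch_quotient_tendsto_0:
  fixes q :: complex
  assumes q: "norm q < 1"
  shows "(\<lambda>m. qpoch q (r + m) * (-1) ^ m * q ^ ((m choose 2) + m * s) * (1 - q ^ m)
      / (qpoch q m * qpoch q (t + m)))
           \<longlonglongrightarrow> 0"
    and "(\<lambda>m. (-1) ^ m * q ^ ((m choose 2) + m * s) / qpoch q (t + m)) \<longlonglongrightarrow> 0"
proof -
  define c where "c = 1 / (1 - norm q)"
  have c: "c \<ge> 1" using q by (simp add: c_def field_simps)
  have pow: "norm (q ^ ((m choose 2) + m * s)) \<le> norm q ^ (m choose 2)" for m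
    using q by (simp add: norm_power power_decreasing)
  have 0: "(\<lambda>m. K * (L ^ m * norm q ^ (m choose 2))) \<longlonglongrightarrow> 0" for K L :: real
    using tendsto_mult_left[OF summable_LIMSEQ_zero[OF summable_power_choose_two[of "norm q" L]], of K] q
        by simp
  show "(\<lambda>m. (-1) ^ m * q ^ ((m choose 2) + m * s) / qpoch q (t + m)) \<longlonglongrightarrow> 0"
  proof (rule Lim_null_comparison)
    show "\<forall>\<^sub>F m in sequentially. norm ((-1) ^ m * q ^ ((m choose 2) + m * s) / qpoch q (t + m))
            \<le> c ^ t * (c ^ m * norm q ^ (m choose 2))"
    proof (intro always_eventually allI)
      fix m
      have "norm ((-1) ^ m * q ^ ((m choose 2) + m * s) / qpoch q (t + m))
          = norm (q ^ ((m choose 2) + m * s)) * norm (1 / qpoch q (t + m))"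
        by (simp add: norm_mult norm_divide norm_power)
      also have "\<dots> \<le> norm q ^ (m choose 2) * c ^ (t + m)"
        using pow norm_inverse_qpoch_le[OF q] by (intro mult_mono) (auto simp: c_def)
      finally show "norm ((-1) ^ m * q ^ ((m choose 2) + m * s) / qpoch q (t + m))
          \<le> c ^ t * (c ^ m * norm q ^ (m choose 2))"
        by (simp add: power_add mult_ac)
    qed
  qed (rule 0)
  show "(\<lambda>m. qpoch q (r + m) * (-1) ^ m * q ^ ((m choose 2) + m * s) * (1 - q ^ m)
      / (qpoch q m * qpoch q (t + m))) \<longlonglongrightarrow> 0"
  proof (rule Lim_null_comparison)
    show "\<forall>\<^sub>F m in sequentially. norm (qpoch q (r + m) * (-1) ^ m * q ^ ((m choose 2) + m * s)
        * (1 - q ^ m) / (qpoch q m * qpoch q (t + m)))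
            \<le> (2 ^ r * 2 * c ^ t) * ((2 * c * c) ^ m * norm q ^ (m choose 2))"
    proof (intro always_eventually allI)
      fix m
      have "norm (1 - q ^ m) \<le> 1 + norm q ^ m"
        by (metis norm_one norm_power norm_triangle_ineq4)
      also have "\<dots> \<le> 2"
        using q power_le_one[of "norm q" m] by simp
      finally have two: "norm (1 - q ^ m) \<le> 2" .
      have "norm (qpoch q (r + m) * (-1) ^ m * q ^ ((m choose 2) + m * s) * (1 - q ^ m)
          / (qpoch q m * qpoch q (t + m)))
          = norm (qpoch q (r + m)) * norm (q ^ ((m choose 2) + m * s)) * norm (1 - q ^ m)
              * norm (1 / qpoch q m) * norm (1 / qpoch q (t + m))"
        by (simp add: norm_mult norm_divide norm_power)
      also have "\<dots> \<le> 2 ^ (r + m) * norm q ^ (m choose 2) * 2 * c ^ m * c ^ (t + m)"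
        using pow norm_inverse_qpoch_le[OF q] norm_qpoch_le[OF q] two c
        by (intro mult_mono mult_nonneg_nonneg) (auto simp flip: c_def)
      finally show "norm (qpoch q (r + m) * (-1) ^ m * q ^ ((m choose 2) + m * s) * (1 - q ^ m)
          / (qpoch q m * qpoch q (t + m)))
            \<le> (2 ^ r * 2 * c ^ t) * ((2 * c * c) ^ m * norm q ^ (m choose 2))"
        by (simp add: power_add power_mult_distrib mult_ac)
    qed
  qed (rule 0)
qed

text \<open>The \<open>\<^sub>1\<phi>\<^sub>1\<close> summation, for parameters that are powers of \<open>q\<close>.\<close>

lemma qpoch_quotient_sums:
  fixes q :: complex
  assumes q: "norm q < 1"
  shows "(\<lambda>m. qpoch q (r + m) * (-1) ^ m * q ^ ((m choose 2) + m * Suc t)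
      / (qpoch q m * qpoch q (r + t + m + 1)))
           sums (qpoch q r / qpoch q t)"
proof (induction r)
  case 0
  define f where "f = (\<lambda>m. (-1) ^ m * q ^ ((m choose 2) + m * Suc t) / qpoch q (t + m))"
  have nz: "qpoch q k \<noteq> 0" "1 - q ^ Suc k \<noteq> 0" for k
    using qpoch_neq_0[OF q] one_minus_power_neq_0[OF q, of "Suc k"] by blast+
  have "(\<lambda>m. f m - f (Suc m)) sums (f 0 - 0)"
    unfolding f_def by (intro telescope_sums' qpoch_quotient_tendsto_0(2)[OF q])
  moreover have "f m - f (Suc m) = qpoch q (0 + m) * (-1) ^ m * q ^ ((m choose 2) + m * Suc t)
      / (qpoch q m * qpoch q (0 + t + m + 1))" for m
  proof -
    have pw: "q ^ ((Suc m choose 2) + Suc m * Suc t) = q ^ ((m choose 2) + m * Suc t) * q ^ Suc (t + m)"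
      unfolding power_add[symmetric] by (rule arg_cong[where f = "power q"]) (simp add: numeral_2_eq_2)
    have "f m = (-1) ^ m * q ^ ((m choose 2) + m * Suc t) * (1 - q ^ Suc (t + m)) / qpoch q (Suc (t + m))"
      using nz by (simp add: f_def qpoch_Suc del: power_Suc)
    moreover have "f (Suc m) = - ((-1) ^ m * q ^ ((m choose 2) + m * Suc t) * q ^ Suc (t + m))
        / qpoch q (Suc (t + m))"
      unfolding f_def pw by simp
    ultimately have "f m - f (Suc m) = ((-1) ^ m * q ^ ((m choose 2) + m * Suc t) * (1 - q ^ Suc (t + m))
        + (-1) ^ m * q ^ ((m choose 2) + m * Suc t) * q ^ Suc (t + m)) / qpoch q (Suc (t + m))"
      by (simp add: add_divide_distrib del: power_Suc)
    also have "\<dots> = (-1) ^ m * q ^ ((m choose 2) + m * Suc t) / qpoch q (Suc (t + m))"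
      by (simp add: right_diff_distrib del: power_Suc)
    finally show ?thesis using nz(1)[of m] by simp
  qed
  ultimately show ?case by (simp add: f_def numeral_2_eq_2)
next
  case (Suc r)
  \<comment> \<open>A certificate for the recurrence in r: \<open>w (Suc r)\<close> equals
    \<open>(1 - q ^ Suc r) * w r\<close> plus q^(r+1) times a difference of \<open>h\<close>. The
    factor 1 - q^m makes \<open>h 0\<close> vanish, so the step only multiplies the sum by 1 -
    q^(r+1).\<close>
  define h where "h = (\<lambda>m. qpoch q (r + m) * (-1) ^ m * q ^ ((m choose 2) + m * Suc t) * (1 - q ^ m)
      / (qpoch q m * qpoch q (r + t + 1 + m)))"
  define w where "w = (\<lambda>r m. qpoch q (r + m) * (-1) ^ m * q ^ ((m choose 2) + m * Suc t)
      / (qpoch q m * qpoch q (r + t + m + 1)))"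
  have nz: "qpoch q k \<noteq> 0" "1 - q ^ Suc k \<noteq> 0" for k
    using qpoch_neq_0[OF q] one_minus_power_neq_0[OF q, of "Suc k"] by blast+
  have "(\<lambda>m. h m - h (Suc m)) sums (h 0 - 0)"
    unfolding h_def by (intro telescope_sums' qpoch_quotient_tendsto_0(1)[OF q])
  then have "(\<lambda>m. (1 - q ^ Suc r) * w r m + q ^ Suc r * (h m - h (Suc m))) sums
      ((1 - q ^ Suc r) * (qpoch q r / qpoch q t) + q ^ Suc r * (h 0 - 0))"
    using Suc unfolding w_def by (intro sums_add sums_mult)
  moreover have "(1 - q ^ Suc r) * w r m + q ^ Suc r * (h m - h (Suc m)) = w (Suc r) m" for m
  proof -
    define X where "X = qpoch q (r + m) * (-1) ^ m * q ^ ((m choose 2) + m * Suc t)"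
    define a b c where "a = q ^ Suc r" and "b = q ^ m" and "c = q ^ Suc t"
    define D where "D = qpoch q m * qpoch q (r + t + m + 1)"
    have k: "q ^ Suc (r + t + m + 1) = a * b * c"
      unfolding a_def b_def c_def power_add[symmetric] by (rule arg_cong[where f = "power q"]) simp
    have k1: "q ^ Suc (r + m) = a * b"
      unfolding a_def b_def power_add[symmetric] by (rule arg_cong[where f = "power q"]) simp
    have pw: "q ^ ((Suc m choose 2) + Suc m * Suc t) = q ^ ((m choose 2) + m * Suc t) * (b * c)"
      unfolding b_def c_def power_add[symmetric]
          by (rule arg_cong[where f = "power q"]) (simp add: numeral_2_eq_2)
    have S: "qpoch q (Suc r + t + m + 1) = qpoch q (r + t + m + 1) * (1 - a * b * c)"
      using qpoch_Suc[of q "r + t + m + 1"] k by simp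
    have nz': "1 - a * b * c \<noteq> 0" "D \<noteq> 0" "1 - b * q \<noteq> 0"
      using nz(2)[of "r + t + m + 1"] nz(1) nz(2)[of m] k by (auto simp: D_def b_def mult_ac)
    have w1: "w r m = X / D"
      by (simp add: w_def X_def D_def)
    have w2: "w (Suc r) m = X * (1 - a * b) / (D * (1 - a * b * c))"
    proof -
      have "qpoch q (Suc r + m) = qpoch q (r + m) * (1 - a * b)"
        using k1 qpoch_Suc[of q "r + m"] by simp
      then show ?thesis unfolding w_def S by (simp add: X_def D_def mult_ac)
    qed
    have h1: "h m = X * (1 - b) / D"
      by (simp add: h_def X_def D_def b_def add_ac)
    have h2: "h (Suc m) = - X * (1 - a * b) * (b * c) / (D * (1 - a * b * c))"
    proof -
      have "h (Suc m) = (qpoch q (r + m) * (1 - a * b)) * (- ((-1) ^ m)) * (q ^ ((m choose 2) + m * Suc t)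
          * (b * c)) * (1 - b * q)
          / ((qpoch q m * (1 - b * q)) * (qpoch q (r + t + m + 1) * (1 - a * b * c)))"
      proof -
        have e: "qpoch q (r + Suc m) = qpoch q (r + m) * (1 - a * b)" "qpoch q (Suc m)
            = qpoch q m * (1 - b * q)"
             "qpoch q (r + t + 1 + Suc m) = qpoch q (r + t + m + 1) * (1 - a * b * c)" "q ^ Suc m = b * q"
          using k1 qpoch_Suc[of q "r + m"] qpoch_Suc[of q m] S by (simp_all add: b_def mult.commute)
        show ?thesis unfolding h_def pw e by (simp only: power_Suc minus_mult_left[symmetric] mult_1_left)
      qed
      also have "\<dots> = - X * (1 - a * b) * (b * c) / (D * (1 - a * b * c))"
        using nz' nz(1) by (simp add: X_def D_def mult_ac)
      finally show ?thesis .
    qed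
    have "(1 - a) * (X / D) + a * (X * (1 - b) / D - (- X * (1 - a * b) * (b * c) / (D * (1 - a * b * c))))
       = X * (1 - a * b) / (D * (1 - a * b * c))"
      using nz' by (simp add: divide_simps) (simp add: algebra_simps)
    then show ?thesis unfolding w1 w2 h1 h2 a_def[symmetric] .
  qed
  moreover have "h 0 = 0" by (simp add: h_def)
  ultimately have "w (Suc r) sums ((1 - q ^ Suc r) * (qpoch q r / qpoch q t))" by simp
  then show ?case by (simp add: w_def qpoch_Suc mult_ac)
qed

section \<open>Rearrangement of double sums and Bailey's lemma\<close>

text \<open>The given series are summed row by row, while exchanging sums and reindexing need
  unconditional summation. A summable bound on the rows provides the absolute convergence that
  connects the two.\<close>

lemma has_sum_Sigma_finite:
  fixes f :: "nat \<times> 'b \<Rightarrow> 'c :: banach"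
  assumes fin: "\<And>n. finite (A n)"
    and bound: "\<And>n x. x \<in> A n \<Longrightarrow> norm (f (n, x)) \<le> b n"
    and b: "summable (\<lambda>n. real (card (A n)) * b n)"
  shows "(f has_sum (\<Sum>n. \<Sum>x\<in>A n. f (n, x))) (Sigma UNIV A)"
proof -
  have le: "norm (\<Sum>x\<in>A n. norm (f (n, x))) \<le> real (card (A n)) * b n" for n
    using sum_bounded_above[of "A n" "\<lambda>x. norm (f (n, x))" "b n"] bound by (simp add: sum_nonneg)
  have "summable (\<lambda>n. norm (\<Sum>x\<in>A n. norm (f (n, x))))"
    by (rule summable_comparison_test[OF _ b]) (use le in auto)
  then have "(\<lambda>n. \<Sum>x\<in>A n. norm (f (n, x))) summable_on UNIV"
    by (rule norm_summable_imp_summable_on)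
  then have "(\<lambda>p. norm (f p)) summable_on Sigma UNIV A"
    by (intro summable_on_SigmaI[where g = "\<lambda>n. \<Sum>x\<in>A n. norm (f (n, x))"]) (auto simp: fin)
  then have S: "(f has_sum infsum f (Sigma UNIV A)) (Sigma UNIV A)"
    using abs_summable_summable has_sum_infsum by blast
  then have "((\<lambda>n. \<Sum>x\<in>A n. f (n, x)) has_sum infsum f (Sigma UNIV A)) UNIV"
    by (rule has_sum_SigmaD) (simp add: fin)
  then have "(\<Sum>n. \<Sum>x\<in>A n. f (n, x)) = infsum f (Sigma UNIV A)"
    using has_sum_imp_sums sums_unique by metis
  then show ?thesis using S by simp
qed

lemma Suc_le_two_power: "real n + 1 \<le> 2 ^ n"
  by (induction n) auto

text \<open>Bailey's lemma relative to q^(d+1): exchange the sums, put n = r + m, and evaluate the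
  sum over m by \<open>qpoch_quotient_sums\<close> with t = r + d. Some geometric bound on
  \<open>a\<close> is needed for the exchange; 4^(r+1) is what both alpha-sides satisfy, their norms
  being at most 4(r+1).\<close>

lemma conjugate_bailey_has_sum:
  fixes q :: complex and a :: "nat \<Rightarrow> complex" and d :: nat
  assumes q: "norm q < 1" and a: "\<And>r. norm (a r) \<le> 4 ^ (r + 1)"
  shows "((\<lambda>r. a r * (-1) ^ r * q ^ ((Suc r choose 2) + d * r) * (qpoch q r / qpoch q (r + d)))
           has_sum (\<Sum>n. \<Sum>r\<le>n. qpoch q n * (-1) ^ n * q ^ ((Suc n choose 2) + d * n)
               * (a r / (qpoch q (n - r) * qpoch q (n + r + d + 1))))) UNIV"
proof -
  define c where "c = 1 / (1 - norm q)"
  have c: "c \<ge> 1" using q by (simp add: c_def field_simps)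
  define f where "f = (\<lambda>(n, r). qpoch q n * (-1) ^ n * q ^ ((Suc n choose 2) + d * n)
      * (a r / (qpoch q (n - r) * qpoch q (n + r + d + 1))))"
  define b where "b = (\<lambda>n. 4 * c ^ (d + 1) * ((2 * 4 * c * c * c) ^ n * norm q ^ (n choose 2)))"
  have "(f has_sum (\<Sum>n. \<Sum>r\<in>{..n}. f (n, r))) (Sigma UNIV (\<lambda>n. {..n}))"
  proof (rule has_sum_Sigma_finite)
    fix n r :: nat assume "r \<in> {..n}"
    then have r: "r \<le> n" by simp
    have "(n choose 2) \<le> (Suc n choose 2) + d * n"
      by (simp add: numeral_2_eq_2)
    then have pow: "norm q ^ ((Suc n choose 2) + d * n) \<le> norm q ^ (n choose 2)"
      using q by (intro power_decreasing) auto
    have "norm (f (n, r)) = norm (qpoch q n) * norm q ^ ((Suc n choose 2) + d * n) * norm (a r)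
        * norm (1 / qpoch q (n - r)) * norm (1 / qpoch q (n + r + d + 1))"
      by (simp add: f_def norm_mult norm_divide norm_power)
    also have "\<dots> \<le> 2 ^ n * norm q ^ (n choose 2) * 4 ^ (n + 1) * c ^ n * c ^ (n + n + d + 1)"
    proof (intro mult_mono mult_nonneg_nonneg)
      show "norm (qpoch q n) \<le> 2 ^ n" by (rule norm_qpoch_le[OF q])
      have "norm (1 / qpoch q (n - r)) \<le> c ^ (n - r)" unfolding c_def by (rule norm_inverse_qpoch_le[OF q])
      also have "\<dots> \<le> c ^ n" using c by (intro power_increasing) auto
      finally show "norm (1 / qpoch q (n - r)) \<le> c ^ n" .
      have "norm (1 / qpoch q (n + r + d + 1)) \<le> c ^ (n + r + d + 1)" unfolding c_def
          by (rule norm_inverse_qpoch_le[OF q])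
      also have "\<dots> \<le> c ^ (n + n + d + 1)" using c r by (intro power_increasing) auto
      finally show "norm (1 / qpoch q (n + r + d + 1)) \<le> c ^ (n + n + d + 1)" .
      have "norm (a r) \<le> 4 ^ (r + 1)" by (rule a)
      also have "\<dots> \<le> 4 ^ (n + 1)" using r by (intro power_increasing) auto
      finally show "norm (a r) \<le> 4 ^ (n + 1)" .
    qed (use pow c in auto)
    also have "\<dots> = b n"
    proof -
      have "(2 * 4 :: real) ^ n = 2 ^ n * 4 ^ n" by (rule power_mult_distrib)
      then show ?thesis
        unfolding b_def power_mult_distrib power_add by (simp only: mult_ac power_one_right)
    qed
    finally show "norm (f (n, r)) \<le> b n" .
  next
    have "summable (\<lambda>n. 4 * c ^ (d + 1) * ((2 * (2 * 4 * c * c * c)) ^ n * norm q ^ (n choose 2)))"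
      using q by (intro summable_mult summable_power_choose_two) auto
    then show "summable (\<lambda>n. real (card {..n}) * b n)"
    proof (rule summable_comparison_test[rotated], intro exI allI impI)
      fix n
      have "b n \<ge> 0" using c by (simp add: b_def)
      then have "norm (real (card {..n}) * b n) = (real n + 1) * b n" by (simp add: add.commute)
      also have "\<dots> \<le> 2 ^ n * b n"
        using \<open>b n \<ge> 0\<close> Suc_le_two_power by (intro mult_right_mono)
      also have "\<dots> = 4 * c ^ (d + 1) * ((2 * (2 * 4 * c * c * c)) ^ n * norm q ^ (n choose 2))"
        unfolding b_def power_mult_distrib[of 2 "2 * 4 * c * c * c"] by (simp only: mult_ac)
      finally show "norm (real (card {..n}) * b n) \<le> \<dots>" .
    qed
  qed simp
  also have "?this \<longleftrightarrow> ((\<lambda>(r, m). f (r + m, r)) has_sum (\<Sum>n. \<Sum>r\<in>{..n}. f (n, r))) (Sigma UNIV (\<lambda>_. UNIV))"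
    by (rule has_sum_reindex_bij_witness[of _ "\<lambda>(r, m). (r + m, r)" "\<lambda>(n, r). (r, n - r)"]) auto
  finally have S: "((\<lambda>(r, m). f (r + m, r)) has_sum (\<Sum>n. \<Sum>r\<in>{..n}. f (n, r))) (Sigma UNIV (\<lambda>_. UNIV))" .
  have "((\<lambda>r. a r * (-1) ^ r * q ^ ((Suc r choose 2) + d * r) * (qpoch q r / qpoch q (r + d)))
      has_sum (\<Sum>n. \<Sum>r\<in>{..n}. f (n, r))) UNIV"
  proof (rule has_sum_SigmaD[OF S], unfold prod.case)
    fix r :: nat
    let ?K = "a r * (-1) ^ r * q ^ ((Suc r choose 2) + d * r)"
    \<comment> \<open>Unconditional summability of each inner series is inherited from the double
      sum; its value is then read off from the ordinary series.\<close>
    have "(\<lambda>m. f (r + m, r)) summable_on UNIV"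
      using summable_on_SigmaD1[OF has_sum_imp_summable[OF S], of r] by simp
    then have *: "((\<lambda>m. f (r + m, r)) has_sum infsum (\<lambda>m. f (r + m, r)) UNIV) UNIV"
      by (rule has_sum_infsum)
    have "(\<lambda>m. f (r + m, r)) sums (?K * (qpoch q r / qpoch q (r + d)))"
    proof -
      have "f (r + m, r) = ?K * (qpoch q (r + m) * (-1) ^ m * q ^ ((m choose 2) + m * Suc (r + d))
          / (qpoch q m * qpoch q (r + (r + d) + m + 1)))" for m
      proof -
        have "(Suc (r + m) choose 2) + d * (r + m) = (Suc r choose 2) + d * r
            + ((m choose 2) + m * Suc (r + d))"
          by (induction m) (simp_all add: numeral_2_eq_2 algebra_simps)
        then have "q ^ ((Suc (r + m) choose 2) + d * (r + m)) = q ^ ((Suc r choose 2) + d * r)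
            * q ^ ((m choose 2) + m * Suc (r + d))"
          by (metis power_add)
        moreover have "r + m + r + d + 1 = r + (r + d) + m + 1" "r + m - r = m" by simp_all
        ultimately show ?thesis unfolding f_def prod.case power_add[of "-1"]
            by (simp only: mult_ac times_divide_eq_right times_divide_eq_left)
      qed
      then show ?thesis using sums_mult[OF qpoch_quotient_sums[OF q, of r "r + d"], of ?K] by simp
    qed
    then have "infsum (\<lambda>m. f (r + m, r)) UNIV = ?K * (qpoch q r / qpoch q (r + d))"
      using has_sum_imp_sums[OF *] sums_unique2 by blast
    then show "((\<lambda>m. f (r + m, r)) has_sum ?K * (qpoch q r / qpoch q (r + d))) UNIV"
      using * by simp
  qed
  then show ?thesis by (simp add: f_def)
qed

text \<open>Expanding the product gives one power of p for each triple (r, i, e), where e selects a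
  summand of 1 + p^v. The bound on \<open>u\<close> serves twice: the subtraction in the exponent is
  never truncated, and the exponent stays at least r(r-1)/2, which makes the expanded sum converge
  absolutely.\<close>

lemma has_sum_powers_of_product:
  fixes p S :: complex and u v m :: "nat \<Rightarrow> nat"
  assumes p: "norm p < 1" "p \<noteq> 0"
    and S: "((\<lambda>r. p ^ u r * (1 + p ^ v r) * (\<Sum>i\<le>m r. 1 / p ^ (Suc i choose 2))) has_sum S) UNIV"
    and u: "\<And>r. (Suc (m r) choose 2) + (r choose 2) \<le> u r" and m: "\<And>r. m r \<le> 2 * r + 1"
  shows "((\<lambda>(r, i, e). p ^ (u r + e * v r - (Suc i choose 2))) has_sum S)
           (Sigma UNIV (\<lambda>r. {..m r} \<times> {..1::nat}))"
proof -
  define f where "f = (\<lambda>(r, i, e). p ^ (u r + e * v r - (Suc i choose 2)))"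
  have mono: "(Suc i choose 2) + (r choose 2) \<le> u r" if "i \<le> m r" for i r
    using binomial_right_mono[of "Suc i" "Suc (m r)" 2] that u[of r] by simp
  have eq: "(\<Sum>x\<in>{..m r} \<times> {..1}. f (r, x)) = p ^ u r * (1 + p ^ v r) * (\<Sum>i\<le>m r. 1 / p ^ (Suc i choose 2))"
      for r
  proof -
    have "(\<Sum>x\<in>{..m r} \<times> {..1}. f (r, x)) = (\<Sum>i\<le>m r. \<Sum>e\<le>1. f (r, i, e))"
      unfolding sum.cartesian_product by (intro sum.cong) auto
    also have "\<dots> = (\<Sum>i\<le>m r. p ^ u r * (1 + p ^ v r) * (1 / p ^ (Suc i choose 2)))"
    proof (intro sum.cong refl)
      fix i assume "i \<in> {..m r}"
      then have "Suc i choose 2 \<le> u r" using mono[of i r] by simp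
      then have "p ^ (u r + k - (Suc i choose 2)) = p ^ u r * p ^ k / p ^ (Suc i choose 2)" for k
        using p(2) by (simp add: power_diff power_add)
      from this[of 0] this[of "v r"] show "(\<Sum>e\<le>1. f (r, i, e)) = p ^ u r * (1 + p ^ v r)
          * (1 / p ^ (Suc i choose 2))"
        by (simp add: f_def algebra_simps add_divide_distrib)
    qed
    finally show ?thesis by (simp add: sum_distrib_left)
  qed
  have "(f has_sum (\<Sum>r. \<Sum>x\<in>{..m r} \<times> {..1}. f (r, x))) (Sigma UNIV (\<lambda>r. {..m r} \<times> {..1::nat}))"
  proof (rule has_sum_Sigma_finite)
    fix r :: nat and x assume "x \<in> {..m r} \<times> {..1::nat}"
    then obtain i e where x: "x = (i, e)" "i \<le> m r" by auto
    then show "norm (f (r, x)) \<le> norm p ^ (r choose 2)"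
      using mono[of i r] p by (auto simp: f_def norm_power intro!: power_decreasing)
  next
    have "summable (\<lambda>r. 4 * (2 ^ r * norm p ^ (r choose 2)))"
      using p by (intro summable_mult summable_power_choose_two) auto
    then show "summable (\<lambda>r. real (card ({..m r} \<times> {..1::nat})) * norm p ^ (r choose 2))"
    proof (rule summable_comparison_test[rotated], intro exI allI impI)
      fix r
      have "real (card ({..m r} \<times> {..1::nat})) \<le> 4 * (real r + 1)"
        using m[of r] by (simp add: card_cartesian_product)
      also have "\<dots> \<le> 4 * 2 ^ r" using Suc_le_two_power[of r] by simp
      finally have "real (card ({..m r} \<times> {..1::nat})) * norm p ^ (r choose 2)
          \<le> 4 * 2 ^ r * norm p ^ (r choose 2)"
        by (intro mult_right_mono) auto
      then show "norm (real (card ({..m r} \<times> {..1::nat})) * norm p ^ (r choose 2))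
          \<le> 4 * (2 ^ r * norm p ^ (r choose 2))"
        by simp
    qed
  qed simp
  moreover have "(\<Sum>r. \<Sum>x\<in>{..m r} \<times> {..1}. f (r, x)) = S"
    using has_sum_imp_sums[OF S] unfolding eq by (rule sums_unique[symmetric])
  ultimately show ?thesis by (simp add: f_def)
qed

section \<open>The series and their even and odd parts\<close>

text \<open>A function of p rather than of p^2 because the even and odd parts in p are needed;
  replacing p by -p changes only the denominator.\<close>

definition bailey_series_term :: "nat \<Rightarrow> complex \<Rightarrow> nat \<Rightarrow> complex" where
  "bailey_series_term d p n =
     qpoch (p ^ 2) n * (-1) ^ n * (p ^ 2) ^ ((Suc n choose 2) + d * n) / shifted_qpoch p (p ^ 2) (Suc n)"

lemma summable_bailey_series:
  assumes p: "norm p < 1"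
  shows "summable (bailey_series_term d p)"
proof (rule summable_comparison_test[rotated])
  define c where "c = 1 / (1 - norm p)"
  have c: "c \<ge> 1" using p by (simp add: c_def field_simps)
  have q: "norm (p ^ 2) < 1" using norm_square_less_1 p by blast
  show "summable (\<lambda>n. c * ((2 * c) ^ n * norm (p ^ 2) ^ (n choose 2)))"
    using q by (intro summable_mult summable_power_choose_two) auto
  show "\<exists>N. \<forall>n\<ge>N. norm (bailey_series_term d p n) \<le> c * ((2 * c) ^ n * norm (p ^ 2) ^ (n choose 2))"
  proof (intro exI allI impI)
    fix n
    have "(n choose 2) \<le> (Suc n choose 2) + d * n"
      by (simp add: numeral_2_eq_2)
    then have pow: "norm (p ^ 2) ^ ((Suc n choose 2) + d * n) \<le> norm (p ^ 2) ^ (n choose 2)"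
      using q by (intro power_decreasing) auto
    have "norm (bailey_series_term d p n) = norm (qpoch (p ^ 2) n) * norm (p ^ 2) ^ ((Suc n choose 2) + d
        * n) * norm (1 / shifted_qpoch p (p ^ 2) (Suc n))"
      by (simp add: bailey_series_term_def norm_mult norm_divide norm_power)
    also have "\<dots> \<le> 2 ^ n * norm (p ^ 2) ^ (n choose 2) * c ^ Suc n"
      using pow norm_qpoch_le[OF q] norm_inverse_shifted_qpoch_le[OF q p] c
      by (intro mult_mono mult_nonneg_nonneg) (auto simp flip: c_def simp del: power_Suc)
    finally show "norm (bailey_series_term d p n) \<le> c * ((2 * c) ^ n * norm (p ^ 2) ^ (n choose 2))"
      by (simp add: power_mult_distrib mult_ac)
  qed
qed

text \<open>The factor p^E turns every negative power into a power with exponent at least 0, of norm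
  at most 1. So the partial theta sums on the alpha-sides cost only linear growth.\<close>

lemma norm_power_times_sum_inverse_powers_le:
  fixes p :: complex
  assumes p: "norm p < 1" "p \<noteq> 0" and E: "Suc m choose 2 \<le> E"
  shows "norm (p ^ E * (\<Sum>i\<le>m. 1 / p ^ (Suc i choose 2))) \<le> real m + 1"
proof -
  have "norm (p ^ E * (\<Sum>i\<le>m. 1 / p ^ (Suc i choose 2))) \<le> (\<Sum>i\<le>m. norm (p ^ E * (1 / p ^ (Suc i choose 2))))"
    unfolding sum_distrib_left by (rule norm_sum)
  also have "\<dots> \<le> (\<Sum>i\<le>m. 1)"
  proof (intro sum_mono)
    fix i assume "i \<in> {..m}"
    then have "Suc i choose 2 \<le> E" using binomial_right_mono[of "Suc i" "Suc m" 2] E by simp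
    then have "p ^ E * (1 / p ^ (Suc i choose 2)) = p ^ (E - (Suc i choose 2))"
      using p(2) by (simp add: power_diff)
    then show "norm (p ^ E * (1 / p ^ (Suc i choose 2))) \<le> 1"
      using p(1) by (simp add: norm_power power_le_one)
  qed
  finally show ?thesis by simp
qed

lemma four_mult_Suc_le_power: "4 * (real r + 1) \<le> 4 ^ (r + 1)"
  by (induction r) auto

text \<open>For d = 0 the quotient of Pochhammer symbols in Bailey's lemma is 1 and the signs (-1)^r
  cancel. The exponent 4r^2 + 3r is 3r^2 + 2r from the alpha-side plus r^2 + r from
  Q^(r(r+1)/2).\<close>

lemma has_sum_bailey_series_even:
  assumes p: "norm p < 1" "p \<noteq> 0"
  shows "((\<lambda>(r, i, e). p ^ (4 * r ^ 2 + 3 * r + e * (2 * r + 1) - (Suc i choose 2)))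
      has_sum (\<Sum>n. bailey_series_term 0 p n))
           (Sigma UNIV (\<lambda>r. {..2 * r} \<times> {..1::nat}))"
proof (rule has_sum_powers_of_product[OF p])
  have q: "norm (p ^ 2) < 1" using norm_square_less_1 p by blast
  define a where "a = (\<lambda>r. (-1) ^ r * p ^ (3 * r ^ 2 + 2 * r) * (1 + p ^ (2 * r + 1))
      * (\<Sum>i\<le>2 * r. 1 / p ^ (Suc i choose 2)))"
  have a: "norm (a r) \<le> 4 ^ (r + 1)" for r
  proof -
    have "norm (1 + p ^ (2 * r + 1)) \<le> norm (1 :: complex) + norm (p ^ (2 * r + 1))"
      by (rule norm_triangle_ineq)
    also have "\<dots> \<le> 2"
      using p power_le_one[of "norm p" "2 * r + 1"] by (simp add: norm_power norm_mult)
    finally have two: "norm (1 + p ^ (2 * r + 1)) \<le> 2" .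
    have "norm (a r) = norm (1 + p ^ (2 * r + 1)) * norm (p ^ (3 * r ^ 2 + 2 * r)
        * (\<Sum>i\<le>2 * r. 1 / p ^ (Suc i choose 2)))"
      by (simp add: a_def norm_mult norm_power)
    also have "\<dots> \<le> 2 * (real (2 * r) + 1)"
      using two norm_power_times_sum_inverse_powers_le[OF p, of "2 * r" "3 * r ^ 2 + 2 * r"]
      by (intro mult_mono) (auto simp: choose_two_double)
    also have "\<dots> \<le> 4 ^ (r + 1)" using four_mult_Suc_le_power[of r] by simp
    finally show ?thesis .
  qed
  have "(\<lambda>n. \<Sum>r\<le>n. qpoch (p ^ 2) n * (-1) ^ n * (p ^ 2) ^ ((Suc n choose 2) + 0 * n)
      * (a r / (qpoch (p ^ 2) (n - r) * qpoch (p ^ 2) (n + r + 0 + 1))))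
      = bailey_series_term 0 p"
    using bailey_pair_even[OF p] unfolding bailey_series_term_def a_def sum_distrib_left[symmetric]
        by (auto intro!: ext)
  moreover have "a r * (-1) ^ r * (p ^ 2) ^ ((Suc r choose 2) + 0 * r) * (qpoch (p ^ 2) r / qpoch (p ^ 2)
      (r + 0))
     = p ^ (4 * r ^ 2 + 3 * r) * (1 + p ^ (2 * r + 1)) * (\<Sum>i\<le>2 * r. 1 / p ^ (Suc i choose 2))" for r
  proof -
    have "p ^ (4 * r ^ 2 + 3 * r) = p ^ (3 * r ^ 2 + 2 * r) * p ^ (r ^ 2 + r)"
      unfolding power_add[symmetric] by (rule arg_cong[where f = "power p"]) simp
    then show ?thesis
      using qpoch_neq_0[OF q] power_mult_distrib[of "-1 :: complex" "-1" r]
      by (simp add: a_def power_square_choose_two mult_ac)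
  qed
  ultimately show "((\<lambda>r. p ^ (4 * r ^ 2 + 3 * r) * (1 + p ^ (2 * r + 1))
      * (\<Sum>i\<le>2 * r. 1 / p ^ (Suc i choose 2)))
      has_sum (\<Sum>n. bailey_series_term 0 p n)) UNIV"
    using conjugate_bailey_has_sum[OF q a, of 0] by simp
  fix r :: nat
  have "2 * (r choose 2) \<le> 2 * (2 * r ^ 2)"
    by (cases r) (simp_all only: two_times_choose_two, simp_all add: power2_eq_square)
  then show "(Suc (2 * r) choose 2) + (r choose 2) \<le> 4 * r ^ 2 + 3 * r"
    unfolding choose_two_double by simp
qed simp

text \<open>For d = 1 the quotient of Pochhammer symbols is 1/(1 - p^(2r+2)) and reduces 1 -
  p^(4r+4) to 1 + p^(2r+2). The exponent is the sum of 3r^2 + 4r + 1, r^2 + r, 2r, and 2 from the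
  prefactor p^2.\<close>

lemma has_sum_bailey_series_odd:
  assumes p: "norm p < 1" "p \<noteq> 0"
  shows "((\<lambda>(r, i, e). p ^ (4 * r ^ 2 + 7 * r + 3 + e * (2 * r + 2) - (Suc i choose 2)))
      has_sum (p ^ 2 * (\<Sum>n. bailey_series_term 1 p n)))
           (Sigma UNIV (\<lambda>r. {..2 * r + 1} \<times> {..1::nat}))"
proof (rule has_sum_powers_of_product[OF p])
  have q: "norm (p ^ 2) < 1" using norm_square_less_1 p by blast
  define a where "a = (\<lambda>r. (-1) ^ r * p ^ (3 * r ^ 2 + 4 * r + 1) * (1 - p ^ (4 * r + 4))
      * (\<Sum>i\<le>2 * r + 1. 1 / p ^ (Suc i choose 2)))"
  have a: "norm (a r) \<le> 4 ^ (r + 1)" for r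
  proof -
    have "norm (1 - p ^ (4 * r + 4)) \<le> norm (1 :: complex) + norm (p ^ (4 * r + 4))"
      by (rule norm_triangle_ineq4)
    also have "\<dots> \<le> 2"
      using p power_le_one[of "norm p" "4 * r + 4"] by (simp add: norm_power norm_mult)
    finally have two: "norm (1 - p ^ (4 * r + 4)) \<le> 2" .
    have "norm (a r) = norm (1 - p ^ (4 * r + 4)) * norm (p ^ (3 * r ^ 2 + 4 * r + 1)
        * (\<Sum>i\<le>2 * r + 1. 1 / p ^ (Suc i choose 2)))"
      by (simp add: a_def norm_mult norm_power)
    also have "\<dots> \<le> 2 * (real (2 * r + 1) + 1)"
      using two norm_power_times_sum_inverse_powers_le[OF p, of "2 * r + 1" "3 * r ^ 2 + 4 * r + 1"]
      by (intro mult_mono) (auto simp: choose_two_double_Suc)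
    also have "\<dots> \<le> 4 ^ (r + 1)" using four_mult_Suc_le_power[of r] by simp
    finally show ?thesis .
  qed
  have "(\<lambda>n. \<Sum>r\<le>n. qpoch (p ^ 2) n * (-1) ^ n * (p ^ 2) ^ ((Suc n choose 2) + 1 * n)
      * (a r / (qpoch (p ^ 2) (n - r) * qpoch (p ^ 2) (n + r + 1 + 1))))
      = bailey_series_term 1 p"
    using bailey_pair_odd[OF p] unfolding bailey_series_term_def a_def sum_distrib_left[symmetric]
        by (auto intro!: ext)
  moreover have "p ^ 2 * (a r * (-1) ^ r * (p ^ 2) ^ ((Suc r choose 2) + 1 * r)
      * (qpoch (p ^ 2) r / qpoch (p ^ 2) (r + 1)))
     = p ^ (4 * r ^ 2 + 7 * r + 3) * (1 + p ^ (2 * r + 2)) * (\<Sum>i\<le>2 * r + 1. 1 / p ^ (Suc i choose 2))" for r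
  proof -
    define X where "X = (\<Sum>i\<le>2 * r + 1. 1 / p ^ (Suc i choose 2))"
    have nz: "1 - p ^ (2 * r + 2) \<noteq> 0" by (rule one_minus_power_neq_0[OF p(1)]) simp
    have P: "qpoch (p ^ 2) r / qpoch (p ^ 2) (r + 1) = 1 / (1 - p ^ (2 * r + 2))"
      using qpoch_square_Suc[OF p, of r] qpoch_neq_0[OF q, of r] by simp
    have f: "1 - p ^ (4 * r + 4) = (1 + p ^ (2 * r + 2)) * (1 - p ^ (2 * r + 2))"
    proof -
      have "p ^ (4 * r + 4) = p ^ (2 * r + 2) * p ^ (2 * r + 2)"
        unfolding power_add[symmetric] by (rule arg_cong[where f = "power p"]) simp
      then show ?thesis by (simp only:) (simp add: algebra_simps)
    qed
    have "p ^ (4 * r ^ 2 + 7 * r + 3)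
        = p ^ 2 * (p ^ (3 * r ^ 2 + 4 * r + 1) * (p ^ (r ^ 2 + r) * p ^ (2 * r)))"
      unfolding power_add[symmetric] by (rule arg_cong[where f = "power p"]) simp
    moreover have "(p ^ 2) ^ ((Suc r choose 2) + 1 * r) = p ^ (r ^ 2 + r) * p ^ (2 * r)"
      unfolding power_add[of "p ^ 2"] power_square_choose_two by (simp add: power_mult)
    moreover have "(-1 :: complex) ^ r * (-1) ^ r = 1"
      by (simp flip: power_mult_distrib)
    ultimately show ?thesis unfolding a_def P f X_def[symmetric]
      using nz by simp
  qed
  ultimately show "((\<lambda>r. p ^ (4 * r ^ 2 + 7 * r + 3) * (1 + p ^ (2 * r + 2))
      * (\<Sum>i\<le>2 * r + 1. 1 / p ^ (Suc i choose 2)))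
      has_sum (p ^ 2 * (\<Sum>n. bailey_series_term 1 p n))) UNIV"
    using has_sum_cmult_right[OF conjugate_bailey_has_sum[OF q a, of 1], of "p ^ 2"] by simp
  fix r :: nat
  have "2 * (r choose 2) \<le> 2 * (2 * r ^ 2)"
    by (cases r) (simp_all only: two_times_choose_two, simp_all add: power2_eq_square)
  then show "(Suc (2 * r + 1) choose 2) + (r choose 2) \<le> 4 * r ^ 2 + 7 * r + 3"
    using choose_two_double_Suc[of r] by simp
qed simp

section \<open>L1 to L4 as even and odd parts in p\<close>

lemma partial_fractions_sum_difference:
  fixes p :: complex
  assumes p: "norm p < 1"
  defines "q \<equiv> p ^ 2"
  shows "(\<Sum>k\<le>n. (-1) ^ k * q ^ (Suc k choose 2) / (qpoch q (n - k) * qpoch q k * (1 - q ^ (2 * k + 1))))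
           = (1 / shifted_qpoch p q (Suc n) + 1 / shifted_qpoch (- p) q (Suc n)) / 2"
    and "p * (\<Sum>k\<le>n. (-1) ^ k * q ^ ((Suc k choose 2) + k) / (qpoch q (n - k) * qpoch q k
        * (1 - q ^ (2 * k + 1))))
           = (1 / shifted_qpoch p q (Suc n) - 1 / shifted_qpoch (- p) q (Suc n)) / 2"
proof -
  have q: "norm q < 1" unfolding q_def by (rule norm_square_less_1[OF p])
  have p': "norm (- p) < 1" using p by simp
  define X where "X = (\<lambda>k. (-1) ^ k * q ^ (Suc k choose 2) / (qpoch q (n - k) * qpoch q k))"
  have nz: "1 - p * q ^ k \<noteq> 0" "1 + p * q ^ k \<noteq> 0" for k
    using one_minus_mult_power_neq_0[OF q p, of k] one_minus_mult_power_neq_0[OF q p', of k] by auto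
  have sq: "1 - q ^ (2 * k + 1) = (1 - p * q ^ k) * (1 + p * q ^ k)" for k
  proof -
    have "q ^ (2 * k + 1) = (p * q ^ k) ^ 2"
      by (simp add: q_def power_mult_distrib power_mult[symmetric] mult.commute)
    then show ?thesis by (simp add: power2_eq_square algebra_simps)
  qed
  have pf: "1 / shifted_qpoch p q (Suc n) = (\<Sum>k\<le>n. X k / (1 - p * q ^ k))"
    "1 / shifted_qpoch (- p) q (Suc n) = (\<Sum>k\<le>n. X k / (1 + p * q ^ k))"
    using partial_fractions[OF q p, of n] partial_fractions[OF q p', of n] by (simp_all add: X_def)
  have "(1 / shifted_qpoch p q (Suc n) + 1 / shifted_qpoch (- p) q (Suc n)) / 2
      = (\<Sum>k\<le>n. X k / (1 - q ^ (2 * k + 1)))"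
    unfolding pf sum.distrib[symmetric] sum_divide_distrib sq
    by (intro sum.cong refl) (use nz in \<open>simp add: divide_simps\<close>, simp add: algebra_simps)
  then show "(\<Sum>k\<le>n. (-1) ^ k * q ^ (Suc k choose 2) / (qpoch q (n - k) * qpoch q k * (1 - q ^ (2 * k + 1))))
           = (1 / shifted_qpoch p q (Suc n) + 1 / shifted_qpoch (- p) q (Suc n)) / 2"
    by (simp add: X_def)
  have "(1 / shifted_qpoch p q (Suc n) - 1 / shifted_qpoch (- p) q (Suc n)) / 2
      = (\<Sum>k\<le>n. X k * (p * q ^ k) / (1 - q ^ (2 * k + 1)))"
    unfolding pf sum_subtractf[symmetric] sum_divide_distrib sq
    by (intro sum.cong refl) (use nz in \<open>simp add: divide_simps\<close>, simp add: algebra_simps)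
  then show "p * (\<Sum>k\<le>n. (-1) ^ k * q ^ ((Suc k choose 2) + k) / (qpoch q (n - k) * qpoch q k
      * (1 - q ^ (2 * k + 1))))
           = (1 / shifted_qpoch p q (Suc n) - 1 / shifted_qpoch (- p) q (Suc n)) / 2"
    by (simp add: X_def sum_distrib_left power_add mult_ac)
qed

definition bailey_series :: "nat \<Rightarrow> complex \<Rightarrow> complex" where
  "bailey_series d p = (\<Sum>n. bailey_series_term d p n)"

lemma bailey_series_sums: "norm p < 1 \<Longrightarrow> bailey_series_term d p sums bailey_series d p"
  unfolding bailey_series_def using summable_bailey_series summable_sums by blast

lemma bailey_series_term_minus:
  "bailey_series_term d (- p) n =
     qpoch (p ^ 2) n * (-1) ^ n * (p ^ 2) ^ ((Suc n choose 2) + d * n) / shifted_qpoch (- p) (p ^ 2)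
         (Suc n)"
  by (simp add: bailey_series_term_def)

context
  fixes p :: complex
  assumes p: "norm p < 1"
begin

lemma bailey_series_sum_sums:
  "(\<lambda>n. (bailey_series_term d p n + bailey_series_term d (- p) n) / 2)
      sums ((bailey_series d p + bailey_series d (- p)) / 2)"
  using p by (intro sums_divide sums_add bailey_series_sums) auto

lemma bailey_series_diff_sums:
  "(\<lambda>n. (bailey_series_term d p n - bailey_series_term d (- p) n) / 2)
      sums ((bailey_series d p - bailey_series d (- p)) / 2)"
  using p by (intro sums_divide sums_diff bailey_series_sums) auto

lemma bailey_series_term_sum:
  "(bailey_series_term d p n + bailey_series_term d (- p) n) / 2 =
     qpoch (p ^ 2) n * (-1) ^ n * (p ^ 2) ^ ((Suc n choose 2) + d * n) *
     (\<Sum>k\<le>n. (-1) ^ k * (p ^ 2) ^ (Suc k choose 2) / (qpoch (p ^ 2) (n - k) * qpoch (p ^ 2) k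
         * (1 - (p ^ 2) ^ (2 * k + 1))))"
  unfolding partial_fractions_sum_difference(1)[OF p] bailey_series_term_minus bailey_series_term_def[of d
      p]
  by (simp add: algebra_simps add_divide_distrib)

lemma bailey_series_term_diff:
  "(bailey_series_term d p n - bailey_series_term d (- p) n) / 2 =
     qpoch (p ^ 2) n * (-1) ^ n * (p ^ 2) ^ ((Suc n choose 2) + d * n) *
     (p * (\<Sum>k\<le>n. (-1) ^ k * (p ^ 2) ^ ((Suc k choose 2) + k) / (qpoch (p ^ 2) (n - k) * qpoch (p ^ 2) k
         * (1 - (p ^ 2) ^ (2 * k + 1)))))"
  unfolding partial_fractions_sum_difference(2)[OF p] bailey_series_term_minus bailey_series_term_def[of d
      p]
  by (simp add: algebra_simps diff_divide_distrib)

lemma L2_eq: "L2 (p ^ 2) = (bailey_series 0 p + bailey_series 0 (- p)) / 2"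
proof -
  have "(\<Sum>k\<in>{0..n}. qpoch (p ^ 2) n * (-1) ^ (n + k) * (p ^ 2) ^ (((n + 1) choose 2) + ((k + 1) choose 2))
     / (qpoch (p ^ 2) (n - k) * qpoch (p ^ 2) k * (1 - (p ^ 2) ^ (2 * k + 1))))
     = (bailey_series_term 0 p n + bailey_series_term 0 (- p) n) / 2" for n
    unfolding bailey_series_term_sum sum_distrib_left atLeast0AtMost
    by (intro sum.cong refl) (simp add: power_add mult_ac)
  then show ?thesis
    unfolding L2_def by (simp only: sums_unique[OF bailey_series_sum_sums])
qed

text \<open>The exponent k(k-1)/2 does not fit the odd part directly. With z = Q^(2k+1), write 1/(1
  - z) = 1 + z/(1 - z). The summand 1 gives the sum in \<open>q_binomial_at_one\<close>, which is
  zero except for the value 1 at n = 0; this cancels the -1 in L4. In the other summand z raises the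
  exponent to that of the odd part plus 1, and Q = p^2 leaves one spare factor p.\<close>

lemma L4_eq: "L4 (p ^ 2) = p * ((bailey_series 0 p - bailey_series 0 (- p)) / 2)"
proof -
  have "(\<Sum>k\<in>{0..n}. qpoch (p ^ 2) n * (-1) ^ (n + k) * (p ^ 2) ^ (((n + 1) choose 2) + (k choose 2))
     / (qpoch (p ^ 2) (n - k) * qpoch (p ^ 2) k * (1 - (p ^ 2) ^ (2 * k + 1))))
     = (if n = 0 then 1 else 0) + p * ((bailey_series_term 0 p n - bailey_series_term 0 (- p) n) / 2)"
         (is "?l n = _") for n
  proof -
    define A where "A = qpoch (p ^ 2) n * (-1) ^ n * (p ^ 2) ^ (Suc n choose 2)"
    define D where "D = (\<lambda>k. qpoch (p ^ 2) (n - k) * qpoch (p ^ 2) k)"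
    have "?l n = (\<Sum>k\<le>n. A * ((-1) ^ k * (p ^ 2) ^ (k choose 2) / D k)
        + A * (p * (p * ((-1) ^ k * (p ^ 2) ^ ((Suc k choose 2) + k)
            / (D k * (1 - (p ^ 2) ^ (2 * k + 1)))))))"
      unfolding atLeast0AtMost
    proof (intro sum.cong refl)
      fix k
      define z where "z = (p ^ 2) ^ (2 * k + 1)"
      have z: "1 - z \<noteq> 0" unfolding z_def by (rule one_minus_power_neq_0[OF norm_square_less_1[OF p]]) simp
      have e: "p * (p * (p ^ 2) ^ ((Suc k choose 2) + k)) = (p ^ 2) ^ (k choose 2) * z"
      proof -
        have "p * (p * (p ^ 2) ^ ((Suc k choose 2) + k)) = p ^ 2 * (p ^ 2) ^ ((Suc k choose 2) + k)"
          by (simp add: power2_eq_square mult_ac)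
        also have "\<dots> = (p ^ 2) ^ (k choose 2) * z"
          unfolding z_def power_add[symmetric] power_Suc[symmetric]
          by (rule arg_cong[where f = "power (p ^ 2)"]) (simp add: numeral_2_eq_2)
        finally show ?thesis .
      qed
      have "qpoch (p ^ 2) n * (-1) ^ (n + k) * (p ^ 2) ^ (((n + 1) choose 2) + (k choose 2))
          / (D k * (1 - z))
          = A * ((-1) ^ k * (p ^ 2) ^ (k choose 2) / D k) * (1 / (1 - z))"
        by (simp add: A_def power_add mult_ac)
      also have "1 / (1 - z) = 1 + z / (1 - z)"
        using z by (simp add: divide_simps)
      also have "A * ((-1) ^ k * (p ^ 2) ^ (k choose 2) / D k) * (1 + z / (1 - z))
          = A * ((-1) ^ k * (p ^ 2) ^ (k choose 2) / D k) + A * ((-1) ^ k * ((p ^ 2) ^ (k choose 2) * z)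
              / (D k * (1 - z)))"
        by (simp only: distrib_left mult_1_right) (simp add: mult_ac)
      also have "\<dots> = A * ((-1) ^ k * (p ^ 2) ^ (k choose 2) / D k) + A
          * (p * (p * ((-1) ^ k * (p ^ 2) ^ ((Suc k choose 2) + k) / (D k * (1 - z)))))"
        unfolding e[symmetric] by (simp only: mult_ac times_divide_eq_right)
      finally show "qpoch (p ^ 2) n * (-1) ^ (n + k) * (p ^ 2) ^ (((n + 1) choose 2) + (k choose 2))
         / (qpoch (p ^ 2) (n - k) * qpoch (p ^ 2) k * (1 - (p ^ 2) ^ (2 * k + 1))) = \<dots>"
        unfolding D_def z_def .
    qed
    also have "\<dots> = A * (\<Sum>k\<le>n. (-1) ^ k * (p ^ 2) ^ (k choose 2) / D k)
        + p * (A * (p * (\<Sum>k\<le>n. (-1) ^ k * (p ^ 2) ^ ((Suc k choose 2) + k)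
            / (D k * (1 - (p ^ 2) ^ (2 * k + 1))))))"
      by (simp add: sum.distrib sum_distrib_left mult_ac)
    also have "A * (\<Sum>k\<le>n. (-1) ^ k * (p ^ 2) ^ (k choose 2) / D k) = (if n = 0 then 1 else 0)"
      using q_binomial_at_one[OF norm_square_less_1[OF p], of n] by (auto simp: D_def A_def numeral_2_eq_2)
    finally show ?thesis
      unfolding bailey_series_term_diff by (simp add: A_def D_def)
  qed
  note eq = this
  have S: "(\<lambda>n. (if n = 0 then 1 else 0) + p * ((bailey_series_term 0 p n - bailey_series_term 0 (- p) n)
      / 2))
      sums (1 + p * ((bailey_series 0 p - bailey_series 0 (- p)) / 2))"
    by (intro sums_add sums_mult bailey_series_diff_sums) (rule sums_single)
  show ?thesis
    unfolding L4_def eq sums_unique[OF S, symmetric] by simp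
qed

text \<open>Both indices are shifted by one; the row n = 0 is empty. Each triangular exponent then
  releases a factor Q = p^2 and a linear term: n, matching d = 1, and k, matching the odd part. One
  factor p is absorbed by the odd part.\<close>

lemma L1_eq: "L1 (p ^ 2) = p * (p ^ 2 * ((bailey_series 1 p - bailey_series 1 (- p)) / 2))"
proof -
  let ?f = "\<lambda>n. \<Sum>k\<in>{1..n}. qpoch (p ^ 2) (n - 1) * (-1) ^ (n + k) * (p ^ 2) ^ (((n + 1) choose 2)
      + ((k + 1) choose 2))
     / (qpoch (p ^ 2) (n - k) * qpoch (p ^ 2) (k - 1) * (1 - (p ^ 2) ^ (2 * k - 1)))"
  have eq: "?f (Suc n) = p * (p ^ 2 * ((bailey_series_term 1 p n - bailey_series_term 1 (- p) n) / 2))"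
      for n
    unfolding bailey_series_term_diff sum_distrib_left One_nat_def sum.atLeast1_atMost_eq
        lessThan_Suc_atMost
    by (intro sum.cong refl)
      (simp add: Suc_Suc_choose_two power_add mult_ac power2_eq_square)
  have S: "(\<lambda>n. p * (p ^ 2 * ((bailey_series_term 1 p n - bailey_series_term 1 (- p) n) / 2)))
      sums (p * (p ^ 2 * ((bailey_series 1 p - bailey_series 1 (- p)) / 2)))"
    by (intro sums_mult bailey_series_diff_sums)
  have "(\<lambda>n. ?f (Suc n)) sums (p * (p ^ 2 * ((bailey_series 1 p - bailey_series 1 (- p)) / 2)))"
    unfolding eq by (rule S)
  from sums_Suc[OF this] have "?f sums (p * (p ^ 2 * ((bailey_series 1 p - bailey_series 1 (- p)) / 2)))"
    by simp
  then show ?thesis unfolding L1_def by (rule sums_unique[symmetric])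
qed

text \<open>The same shift as in \<open>L1_eq\<close>, but k(k-1)/2 becomes k(k+1)/2 with no linear
  term, which is the exponent of the even part. One factor p^2 comes from the shift of n, the other
  is the prefactor q of L3.\<close>

lemma L3_eq: "L3 (p ^ 2) = p ^ 2 * (p ^ 2 * ((bailey_series 1 p + bailey_series 1 (- p)) / 2))"
proof -
  let ?f = "\<lambda>n. \<Sum>k\<in>{1..n}. qpoch (p ^ 2) (n - 1) * (-1) ^ (n + k) * (p ^ 2) ^ (((n + 1) choose 2)
      + (k choose 2))
     / (qpoch (p ^ 2) (n - k) * qpoch (p ^ 2) (k - 1) * (1 - (p ^ 2) ^ (2 * k - 1)))"
  have eq: "?f (Suc n) = p ^ 2 * ((bailey_series_term 1 p n + bailey_series_term 1 (- p) n) / 2)" for n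
    unfolding bailey_series_term_sum sum_distrib_left One_nat_def sum.atLeast1_atMost_eq lessThan_Suc_atMost
    by (intro sum.cong refl)
      (simp add: Suc_Suc_choose_two power_add mult_ac power2_eq_square)
  have S: "(\<lambda>n. p ^ 2 * ((bailey_series_term 1 p n + bailey_series_term 1 (- p) n) / 2))
      sums (p ^ 2 * ((bailey_series 1 p + bailey_series 1 (- p)) / 2))"
    by (intro sums_mult bailey_series_sum_sums)
  have "(\<lambda>n. ?f (Suc n)) sums (p ^ 2 * ((bailey_series 1 p + bailey_series 1 (- p)) / 2))"
    unfolding eq by (rule S)
  from sums_Suc[OF this] have "?f sums (p ^ 2 * ((bailey_series 1 p + bailey_series 1 (- p)) / 2))"
    by simp
  then show ?thesis unfolding L3_def by (simp only: sums_unique[symmetric])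
qed

end

section \<open>Ideals of the ring of integers\<close>

lemma OK_simps [simp]:
  "carrier OK = UNIV" "Group.monoid.mult OK = zs_mult" "Group.monoid.one OK = (1, 0)"
  "Ring.ring.zero OK = (0, 0)" "Ring.ring.add OK = zs_add"
  by (simp_all add: OK_def)

lemma cring_OK: "cring OK"
proof (rule cringI)
  show "abelian_group OK"
  proof (rule abelian_groupI)
    fix x :: "int \<times> int"
    show "\<exists>y\<in>carrier OK. y \<oplus>\<^bsub>OK\<^esub> x = \<zero>\<^bsub>OK\<^esub>"
      by (rule bexI[of _ "(- fst x, - snd x)"]) (auto simp: zs_add_def)
  qed (auto simp: zs_add_def)
  show "comm_monoid OK"
    by (rule comm_monoidI) (auto simp: zs_mult_def algebra_simps)
qed (auto simp: zs_mult_def zs_add_def algebra_simps)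

definition zs_norm :: "int \<times> int \<Rightarrow> int" where
  "zs_norm a = fst a ^ 2 - 2 * snd a ^ 2"

definition zs_ideal :: "int \<times> int \<Rightarrow> (int \<times> int) set" where
  "zs_ideal a = range (\<lambda>x. zs_mult x a)"

lemma zs_mult_simp [simp]: "zs_mult (a, b) (c, d) = (a * c + 2 * b * d, a * d + b * c)"
  by (simp add: zs_mult_def)

lemma zs_mult_assoc: "zs_mult (zs_mult x y) z = zs_mult x (zs_mult y z)"
  by (simp add: zs_mult_def algebra_simps)

lemma zs_norm_simp [simp]: "zs_norm (a, b) = a ^ 2 - 2 * b ^ 2"
  by (simp add: zs_norm_def)

lemma zs_norm_mult: "zs_norm (zs_mult x y) = zs_norm x * zs_norm y"
  by (simp add: zs_norm_def zs_mult_def power2_eq_square algebra_simps)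

text \<open>Irrationality of sqrt 2 by descent: x = 2a turns a solution (x, y) into the smaller
  solution (y, a).\<close>

lemma square_eq_two_square_imp_0:
  fixes x y :: int
  shows "x ^ 2 = 2 * y ^ 2 \<Longrightarrow> x = 0 \<and> y = 0"
proof (induction "nat \<bar>x\<bar>" arbitrary: x y rule: less_induct)
  case less
  show ?case
  proof (cases "x = 0")
    case True
    then show ?thesis using less.prems by simp
  next
    case False
    have "even (x ^ 2)" using less.prems by simp
    then obtain a where a: "x = 2 * a" by (auto elim: evenE)
    then have y: "y ^ 2 = 2 * a ^ 2" using less.prems by (simp add: power2_eq_square)
    have "\<bar>y\<bar> < \<bar>x\<bar>"
    proof (rule ccontr)
      assume "\<not> \<bar>y\<bar> < \<bar>x\<bar>"
      then have "x ^ 2 \<le> y ^ 2" unfolding abs_le_square_iff[symmetric] by simp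
      then have "x ^ 2 \<le> 0" using less.prems by simp
      then show False using False by simp
    qed
    then have "y = 0 \<and> a = 0" using less.hyps[of y a] y by simp
    then show ?thesis using a by simp
  qed
qed

lemma zs_norm_eq_0_iff: "zs_norm a = 0 \<longleftrightarrow> a = (0, 0)"
  using square_eq_two_square_imp_0[of "fst a" "snd a"] by (auto simp: zs_norm_def prod_eq_iff)

lemma zs_ideal_eq_cgenideal: "zs_ideal a = PIdl\<^bsub>OK\<^esub> a"
  by (auto simp: zs_ideal_def cgenideal_def)

lemma zs_ideal_ideal: "ideal (zs_ideal a) OK"
  unfolding zs_ideal_eq_cgenideal by (rule cring.cgenideal_ideal[OF cring_OK]) simp

lemma zs_ideal_self: "a \<in> zs_ideal a"
  unfolding zs_ideal_def by (rule range_eqI[of _ _ "(1, 0)"]) (simp add: zs_mult_def)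

lemma zs_ideal_in_nonzero_ideals: "a \<noteq> (0, 0) \<Longrightarrow> zs_ideal a \<in> nonzero_ideals"
  using zs_ideal_ideal[of a] zs_ideal_self[of a] by (auto simp: nonzero_ideals_def)

lemma ideal_OK_closed:
  assumes "ideal I OK"
  shows "(0, 0) \<in> I" "x \<in> I \<Longrightarrow> y \<in> I \<Longrightarrow> zs_add x y \<in> I" "x \<in> I \<Longrightarrow> zs_mult y x \<in> I"
proof -
  interpret ideal I OK by fact
  show "(0, 0) \<in> I" using additive_subgroup.zero_closed[OF is_additive_subgroup] by simp
  show "x \<in> I \<Longrightarrow> y \<in> I \<Longrightarrow> zs_add x y \<in> I" using additive_subgroup.a_closed[OF is_additive_subgroup] by simp
  show "x \<in> I \<Longrightarrow> zs_mult y x \<in> I" using I_l_closed by simp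
qed

section \<open>Euclidean division, principal ideals and their index\<close>

lemma round_division:
  fixes a n :: int
  assumes "n \<noteq> 0"
  shows "\<exists>g r. a = g * n + r \<and> 2 * \<bar>r\<bar> \<le> \<bar>n\<bar>"
proof (cases "2 * (a mod \<bar>n\<bar>) \<le> \<bar>n\<bar>")
  case True
  have "a = (a div \<bar>n\<bar> * sgn n) * n + a mod \<bar>n\<bar>"
    by (metis abs_sgn div_mult_mod_eq mult.assoc mult.commute)
  moreover have "2 * \<bar>a mod \<bar>n\<bar>\<bar> \<le> \<bar>n\<bar>" using True assms by simp
  ultimately show ?thesis by blast
next
  case False
  have "a = (a div \<bar>n\<bar> * sgn n) * n + a mod \<bar>n\<bar>"
    by (metis abs_sgn div_mult_mod_eq mult.assoc mult.commute)
  then have "a = ((a div \<bar>n\<bar> + 1) * sgn n) * n + (a mod \<bar>n\<bar> - \<bar>n\<bar>)"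
    by (simp add: algebra_simps mult_sgn_abs abs_sgn)
  moreover have "2 * \<bar>a mod \<bar>n\<bar> - \<bar>n\<bar>\<bar> \<le> \<bar>n\<bar>"
    using False assms pos_mod_bound[of "\<bar>n\<bar>" a] pos_mod_sign[of "\<bar>n\<bar>" a]
        by (auto simp: abs_if split: if_splits)
  ultimately show ?thesis by blast
qed

text \<open>Round both coordinates of b/a, computed as b times the conjugate \<open>a'\<close> over
  the norm n, to nearest integers. The error (r + s sqrt 2)/n has |r|, |s| at most |n|/2, so its
  norm lies between -1/2 and 1/4.\<close>

lemma zs_euclidean_division:
  assumes "a \<noteq> (0, 0)"
  shows "\<exists>g. \<bar>zs_norm (zs_add b (zs_mult g a))\<bar> < \<bar>zs_norm a\<bar>"
proof -
  define n where "n = zs_norm a"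
  have n: "n \<noteq> 0" using assms by (simp add: n_def zs_norm_eq_0_iff)
  define a' where "a' = (fst a, - snd a)"
  obtain g h r s where g: "fst (zs_mult b a') = g * n + r" "2 * \<bar>r\<bar> \<le> \<bar>n\<bar>"
      and h: "snd (zs_mult b a') = h * n + s" "2 * \<bar>s\<bar> \<le> \<bar>n\<bar>"
    using round_division[OF n] by metis
  define c where "c = zs_add b (zs_mult (- g, - h) a)"
  have "zs_mult c a' = (r, s)"
  proof -
    have "zs_mult c a' = (fst (zs_mult b a') - g * n, snd (zs_mult b a') - h * n)"
      by (simp add: c_def a'_def n_def zs_add_def zs_mult_def zs_norm_def power2_eq_square algebra_simps)
    then show ?thesis using g h by simp
  qed
  then have "zs_norm c * n = r ^ 2 - 2 * s ^ 2"
    using zs_norm_mult[of c a'] by (simp add: n_def a'_def zs_norm_def)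
  then have "\<bar>zs_norm c\<bar> * \<bar>n\<bar> = \<bar>r ^ 2 - 2 * s ^ 2\<bar>"
    by (metis abs_mult)
  moreover have "4 * r ^ 2 \<le> n ^ 2" "4 * s ^ 2 \<le> n ^ 2"
    using g(2) h(2) power_mono[of "2 * \<bar>r\<bar>" "\<bar>n\<bar>" 2] power_mono[of "2 * \<bar>s\<bar>" "\<bar>n\<bar>" 2]
        by (simp_all add: power_mult_distrib)
  moreover have "r ^ 2 \<ge> 0" "s ^ 2 \<ge> 0" "n ^ 2 > 0" using n by simp_all
  ultimately have "\<bar>zs_norm c\<bar> * \<bar>n\<bar> < n ^ 2" by linarith
  then have "\<bar>zs_norm c\<bar> * \<bar>n\<bar> < \<bar>n\<bar> * \<bar>n\<bar>" by (simp add: power2_eq_square)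
  then have "\<bar>zs_norm c\<bar> < \<bar>n\<bar>" by (rule mult_right_less_imp_less) simp
  then show ?thesis unfolding c_def n_def by blast
qed

lemma nonzero_ideal_principal:
  assumes "I \<in> nonzero_ideals"
  obtains a where "a \<noteq> (0, 0)" "I = zs_ideal a"
proof -
  have I: "ideal I OK" "I \<noteq> {(0, 0)}" using assms by (auto simp: nonzero_ideals_def)
  note closed = ideal_OK_closed[OF I(1)]
  have "\<exists>a. a \<in> I \<and> a \<noteq> (0, 0)" using I(2) closed(1) by auto
  then obtain a where a: "a \<in> I" "a \<noteq> (0, 0)"
      and min: "\<And>b. b \<in> I \<Longrightarrow> b \<noteq> (0, 0) \<Longrightarrow> nat \<bar>zs_norm a\<bar> \<le> nat \<bar>zs_norm b\<bar>"
    using arg_min_nat_lemma[of "\<lambda>a. a \<in> I \<and> a \<noteq> (0, 0)" _ "\<lambda>a. nat \<bar>zs_norm a\<bar>"] by blast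
  have "I = zs_ideal a"
  proof (intro equalityI subsetI)
    fix b assume b: "b \<in> I"
    obtain g where g: "\<bar>zs_norm (zs_add b (zs_mult g a))\<bar> < \<bar>zs_norm a\<bar>"
      using zs_euclidean_division[OF a(2)] by blast
    have "zs_add b (zs_mult g a) \<in> I" using closed(2)[OF b closed(3)[OF a(1)]] .
    then have "zs_add b (zs_mult g a) = (0, 0)" using min g by fastforce
    then have "b = zs_mult (- fst g, - snd g) a"
      by (simp add: zs_add_def zs_mult_def prod_eq_iff algebra_simps)
    then show "b \<in> zs_ideal a" by (auto simp: zs_ideal_def)
  qed (use closed(3)[OF a(1)] in \<open>auto simp: zs_ideal_def\<close>)
  with a(2) show ?thesis using that by blast
qed

text \<open>The lattice spanned by \<open>(m, 0)\<close> and \<open>(e, d)\<close> (Hermite normal form) has index \<open>m * d\<close>.\<close>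

lemma card_quotient_lattice:
  assumes I: "ideal I OK" and md: "m > 0" "d > 0"
    and mem: "\<And>x y. (x, y) \<in> I \<longleftrightarrow> d dvd y \<and> m dvd (x - e * (y div d))"
  shows "card (carrier (OK Quot I)) = nat (m * d)"
proof -
  define C where "C = (\<lambda>a. {z. (fst z - fst a, snd z - snd a) \<in> I})"
  have coset: "I +>\<^bsub>OK\<^esub> a = C a" for a
    unfolding a_r_coset_def' C_def
  proof (safe, goal_cases)
    case (1 z w h1 h2)
    then show ?case by (simp add: zs_add_def)
  next
    case (2 z w)
    then show ?case by (intro UN_I[of "(z - fst a, w - snd a)"]) (auto simp: zs_add_def)
  qed
  have carrier: "carrier (OK Quot I) = range C"
    by (auto simp: FactRing_def A_RCOSETS_def' coset)
  have eq_iff: "C a = C b \<longleftrightarrow> (fst a - fst b, snd a - snd b) \<in> I" for a b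
  proof
    assume "C a = C b"
    moreover have "a \<in> C a" using ideal_OK_closed(1)[OF I] by (simp add: C_def)
    ultimately show "(fst a - fst b, snd a - snd b) \<in> I" by (simp add: C_def)
  next
    assume *: "(fst a - fst b, snd a - snd b) \<in> I"
    have neg: "(fst b - fst a, snd b - snd a) \<in> I"
      using ideal_OK_closed(3)[OF I *, of "(-1, 0)"] by simp
    show "C a = C b"
      using ideal_OK_closed(2)[OF I _ *] ideal_OK_closed(2)[OF I _ neg]
      by (force simp: C_def zs_add_def)
  qed
  have "bij_betw C ({0..<m} \<times> {0..<d}) (range C)"
    unfolding bij_betw_def
  proof
    show "inj_on C ({0..<m} \<times> {0..<d})"
    proof (rule inj_onI, clarify)
      fix i j i' j' assume ij: "i \<in> {0..<m}" "j \<in> {0..<d}" "i' \<in> {0..<m}" "j' \<in> {0..<d}" "C (i, j)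
          = C (i', j')"
      then have "d dvd j - j'" "m dvd (i - i') - e * ((j - j') div d)"
        using eq_iff mem by auto
      have "j mod d = j' mod d" using \<open>d dvd j - j'\<close> by (simp only: mod_eq_dvd_iff)
      then have j: "j = j'" using ij by simp
      have "i mod m = i' mod m" using \<open>m dvd _\<close> by (simp add: j mod_eq_dvd_iff)
      then show "i = i' \<and> j = j'" using ij j by simp
    qed
    have "C a \<in> C ` ({0..<m} \<times> {0..<d})" for a
    proof -
      \<comment> \<open>Subtract multiples of (e, d) to reduce the second coordinate modulo d, then
        multiples of (m, 0) to reduce the first modulo m.\<close>
      define j i where "j = snd a mod d" and "i = (fst a - e * (snd a div d)) mod m"
      have "(snd a - j) div d = snd a div d" "d dvd snd a - j"
        using md by (simp_all add: j_def minus_mod_eq_mult_div)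
      moreover have "m dvd fst a - i - e * (snd a div d)"
        using dvd_minus_mod[of m "fst a - e * (snd a div d)"] by (simp add: i_def algebra_simps)
      ultimately have "C a = C (i, j)" unfolding eq_iff mem by simp
      moreover have "(i, j) \<in> {0..<m} \<times> {0..<d}" using md by (simp add: i_def j_def)
      ultimately show ?thesis by blast
    qed
    then show "C ` ({0..<m} \<times> {0..<d}) = range C" by auto
  qed
  then have "card (range C) = card ({0..<m} \<times> {0..<d})" by (rule bij_betw_same_card[symmetric])
  also have "\<dots> = nat (m * d)" using md by (simp add: card_cartesian_product nat_mult_distrib)
  finally show ?thesis using carrier by simp
qed

text \<open>Hermite normal form of the ideal: (e, d) is (s + t sqrt 2) a with Bezout coefficients s,
  t, and (N, 0) is (x' - y' sqrt 2) a. The index |N| d is then the absolute value of the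
  norm.\<close>

lemma ideal_norm_zs_ideal:
  assumes "a \<noteq> (0, 0)"
  shows "ideal_norm (zs_ideal a) = nat \<bar>zs_norm a\<bar>"
proof -
  obtain x y where a: "a = (x, y)" by (cases a)
  define d where "d = gcd x y"
  have d: "d > 0" using assms by (auto simp: d_def a)
  obtain x' y' where x: "x = d * x'" and y: "y = d * y'"
    by (metis d_def dvdE gcd_dvd1 gcd_dvd2)
  obtain s t where "s * y + t * x = d"
    using bezout_int[of y x] by (auto simp: d_def gcd.commute)
  then have "d * (s * y' + t * x') = d * 1" by (simp add: x y algebra_simps)
  then have st: "s * y' + t * x' = 1" using d by simp
  define N where "N = d * (x' ^ 2 - 2 * y' ^ 2)"
  define e where "e = s * x + 2 * t * y"
  have norm: "zs_norm a = d * N" by (simp add: a x y N_def power2_eq_square algebra_simps)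
  have N: "N \<noteq> 0" using norm assms zs_norm_eq_0_iff[of a] by auto
  have mem: "(X, Y) \<in> zs_ideal a \<longleftrightarrow> d dvd Y \<and> \<bar>N\<bar> dvd (X - e * (Y div d))" for X Y
  proof
    assume "(X, Y) \<in> zs_ideal a"
    then obtain b c where bc: "X = b * x + 2 * c * y" "Y = b * y + c * x"
      by (auto simp: zs_ideal_def a)
    have Y: "Y = d * (b * y' + c * x')" by (simp add: bc x y algebra_simps)
    define k where "k = b * y' + c * x'"
    have "X - e * k = (s * y' + t * x') * X - e * k" using st by simp
    also have "\<dots> = (t * b - s * c) * N"
      by (simp add: bc e_def N_def x y k_def power2_eq_square algebra_simps)
    finally show "d dvd Y \<and> \<bar>N\<bar> dvd (X - e * (Y div d))"
      using Y d by (simp add: k_def)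
  next
    assume *: "d dvd Y \<and> \<bar>N\<bar> dvd (X - e * (Y div d))"
    then obtain k where k: "Y = d * k" by (auto elim: dvdE)
    then have "N dvd X - e * k" using * d by simp
    then obtain l where l: "X - e * k = N * l" by (rule dvdE)
    \<comment> \<open>The coefficients are those of k (s + t sqrt 2) + l (x' - y' sqrt 2), since (X,
      Y) is k (e, d) + l (N, 0).\<close>
    have "X = (k * s + l * x') * x + 2 * (k * t - l * y') * y"
      using l by (simp add: e_def N_def x y power2_eq_square algebra_simps)
    moreover have "Y = (k * s + l * x') * y + (k * t - l * y') * x"
    proof -
      have "(k * s + l * x') * y + (k * t - l * y') * x = d * k * (s * y' + t * x')"
        by (simp add: x y algebra_simps)
      then show ?thesis using st k by simp
    qed
    ultimately have "(X, Y) = zs_mult (k * s + l * x', k * t - l * y') a"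
      by (simp add: a)
    then show "(X, Y) \<in> zs_ideal a" by (auto simp: zs_ideal_def)
  qed
  have "ideal_norm (zs_ideal a) = nat (\<bar>N\<bar> * d)"
    unfolding ideal_norm_def by (rule card_quotient_lattice[OF zs_ideal_ideal _ d mem]) (use N in simp)
  then show ?thesis using d by (simp add: norm abs_mult mult.commute)
qed

lemma zs_ideal_zs_mult_unit:
  assumes "zs_mult v u = (1, 0)"
  shows "zs_ideal (zs_mult u a) = zs_ideal a"
proof (intro equalityI subsetI)
  fix x assume "x \<in> zs_ideal (zs_mult u a)"
  then obtain y where "x = zs_mult y (zs_mult u a)" by (auto simp: zs_ideal_def)
  then have "x = zs_mult (zs_mult y u) a" by (simp add: zs_mult_assoc)
  then show "x \<in> zs_ideal a" by (auto simp: zs_ideal_def)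
next
  fix x assume "x \<in> zs_ideal a"
  then obtain y where "x = zs_mult y a" by (auto simp: zs_ideal_def)
  also have "a = zs_mult (zs_mult v u) a" unfolding assms by (simp add: zs_mult_def)
  finally have "x = zs_mult (zs_mult y v) (zs_mult u a)" by (simp add: zs_mult_assoc)
  then show "x \<in> zs_ideal (zs_mult u a)" by (auto simp: zs_ideal_def)
qed

section \<open>Units and the fundamental domain\<close>

text \<open>
  A fundamental domain, up to its boundary \<open>2 * \<bar>y\<bar> = x\<close>, for the group generated by \<open>-1\<close> and \<open>3 + 2 \<surd>2\<close>
  acting on the elements of positive norm; on the boundary the norm is even.
\<close>

definition fundamental_domain :: "(int \<times> int) set" where
  "fundamental_domain = {(x, y). 2 * \<bar>y\<bar> < x}"

lemma zs_norm_pos_iff_of_domain: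
  assumes "(x, y) \<in> fundamental_domain"
  shows "zs_norm (x, y) > 0"
proof -
  have "(2 * \<bar>y\<bar>) ^ 2 < x ^ 2"
    using assms by (intro power_strict_mono) (auto simp: fundamental_domain_def)
  then have "4 * y ^ 2 < x ^ 2" by (simp add: power_mult_distrib)
  then have "2 * y ^ 2 < x ^ 2" using zero_le_power2[of y] by linarith
  then show ?thesis by simp
qed

text \<open>If b > 0, multiplication by a + b sqrt 2 rotates the domain past the ray x = 2y, or
  makes x nonpositive when a < 0; conjugation handles b < 0. The value b = 1 is impossible because 3
  is not a square, and b >= 2 gives 2a <= 3b, with equality for 3 + 2 sqrt 2.\<close>

lemma fundamental_domain_unit_eq_1:
  assumes "(x, y) \<in> fundamental_domain" "zs_mult (a, b) (x, y) \<in> fundamental_domain" "zs_norm (a, b) = 1"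
  shows "a = 1 \<and> b = 0"
proof -
  have aux: "b \<le> 0" if x: "2 * \<bar>y\<bar> < x" and x': "2 * \<bar>a * y + b * x\<bar> < a * x + 2 * b * y"
      and n: "a ^ 2 - 2 * b ^ 2 = 1"
    for a b x y :: int
  proof (rule ccontr)
    assume "\<not> b \<le> 0"
    then have b: "b \<ge> 1" by simp
    have "b \<noteq> 1"
    proof
      assume "b = 1"
      then have a: "\<bar>a\<bar> ^ 2 = 3" using n by simp
      then have "\<bar>a\<bar> < 2" using power_mono[of 2 "\<bar>a\<bar>" 2] by (rule_tac ccontr) simp
      then have "a = 0 \<or> a = 1 \<or> a = -1" by linarith
      then show False using n \<open>b = 1\<close> by auto
    qed
    then have b: "b \<ge> 2" using b by simp
    have x0: "x > 0" using x by linarith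
    have "a > 0"
    proof (rule ccontr)
      assume "\<not> a > 0"
      moreover have "a \<noteq> 0"
      proof
        assume "a = 0"
        then have "2 * b ^ 2 = -1" using n by simp
        then show False using zero_le_power2[of b] by linarith
      qed
      moreover have "b < \<bar>a\<bar>"
      proof (rule ccontr)
        assume "\<not> b < \<bar>a\<bar>"
        then have "\<bar>a\<bar> ^ 2 \<le> b ^ 2" by (intro power_mono) auto
        then show False using n zero_le_power2[of b] by simp
      qed
      ultimately have "a \<le> - b" by linarith
      then have "a * x \<le> - b * x" using x0 by (intro mult_right_mono) auto
      moreover have "b * (2 * y) \<le> b * x" using x b by (intro mult_left_mono) auto
      ultimately have "a * x + 2 * b * y \<le> 0" by (simp add: algebra_simps)
      then show False using x' abs_ge_zero[of "a * y + b * x"] by simp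
    qed
    have "4 \<le> b ^ 2" using power_mono[of 2 b 2] b by simp
    then have "4 * a ^ 2 \<le> 9 * b ^ 2" using n by linarith
    then have "(2 * a) ^ 2 \<le> (3 * b) ^ 2" by (simp add: power_mult_distrib)
    then have ab: "2 * a \<le> 3 * b" by (rule power2_le_imp_le) (use b in simp)
    have "b \<le> a"
    proof (rule power2_le_imp_le)
      show "b ^ 2 \<le> a ^ 2" using n zero_le_power2[of b] by linarith
    qed (use \<open>a > 0\<close> in simp)
    \<comment> \<open>This product and the next add up to 2 (a y + b x) - (a x + 2 b y), which would
      have to be negative if the image lay in the domain.\<close>
    then have "0 \<le> (a - b) * (x + 2 * y)" using x by (intro mult_nonneg_nonneg) auto
    moreover have "0 \<le> (3 * b - 2 * a) * x" using ab x0 by simp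
    moreover have "2 * (a * y + b * x) < a * x + 2 * b * y"
      by (rule le_less_trans[OF _ x']) (rule mult_left_mono[OF abs_ge_self], simp)
    ultimately show False by (simp add: algebra_simps)
  qed
  have n: "a ^ 2 - 2 * b ^ 2 = 1" using assms(3) by simp
  have x: "2 * \<bar>y\<bar> < x" and x': "2 * \<bar>a * y + b * x\<bar> < a * x + 2 * b * y"
    using assms(1,2) by (auto simp: fundamental_domain_def)
  have "b \<le> 0" using aux[OF x x' n] .
  \<comment> \<open>Conjugation: \<open>aux\<close> is applied to the pairs (x, -y) and (a,
    -b).\<close>
  moreover have "- b \<le> 0"
    by (rule aux[of "- y" x a]) (use x x' n in \<open>auto simp: abs_if algebra_simps split: if_splits\<close>)
  ultimately have b: "b = 0" by simp
  then have "a = 1 \<or> a = -1" using n by (simp add: power2_eq_1_iff)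
  moreover have "a \<noteq> -1" using x x' b by auto
  ultimately show ?thesis using b by simp
qed

text \<open>Two generators of one ideal differ by a unit. Both norms are positive, so the unit has
  norm 1 and \<open>fundamental_domain_unit_eq_1\<close> applies.\<close>

lemma inj_on_zs_ideal_fundamental_domain: "inj_on zs_ideal fundamental_domain"
proof (rule inj_onI)
  fix \<alpha> \<beta> assume \<alpha>: "\<alpha> \<in> fundamental_domain" and \<beta>: "\<beta> \<in> fundamental_domain"
      and eq: "zs_ideal \<alpha> = zs_ideal \<beta>"
  obtain x y where xy: "\<alpha> = (x, y)" by (cases \<alpha>)
  obtain x' y' where xy': "\<beta> = (x', y')" by (cases \<beta>)
  have pos: "zs_norm \<alpha> > 0" "zs_norm \<beta> > 0"
    using zs_norm_pos_iff_of_domain \<alpha> \<beta> xy xy' by auto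
  obtain u where u: "\<beta> = zs_mult u \<alpha>" using zs_ideal_self[of \<beta>, folded eq] by (auto simp: zs_ideal_def)
  obtain v where v: "\<alpha> = zs_mult v \<beta>" using zs_ideal_self[of \<alpha>, unfolded eq] by (auto simp: zs_ideal_def)
  have "zs_norm \<alpha> = zs_norm v * zs_norm u * zs_norm \<alpha>"
    using arg_cong[OF v, of zs_norm] arg_cong[OF u, of zs_norm] by (simp add: zs_norm_mult)
  then have "zs_norm v * zs_norm u = 1" using pos by simp
  moreover have "zs_norm u > 0" using pos u zero_less_mult_pos2[of "zs_norm u" "zs_norm \<alpha>"]
      by (simp add: zs_norm_mult)
  ultimately have "zs_norm u = 1"
      by (metis mult.commute zmult_eq_1_iff less_irrefl neg_0_less_iff_less not_one_less_zero)
  then have "u = (1, 0)"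
    using fundamental_domain_unit_eq_1[of x y "fst u" "snd u"] \<alpha> \<beta> u xy by (simp add: prod_eq_iff)
  then show "\<alpha> = \<beta>" using u by (simp add: zs_mult_def)
qed

text \<open>The unit 1 + sqrt 2 of norm -1 makes the norm of a generator positive, and -1 makes x
  positive. Among such generators one with least x satisfies 2|y| <= x; equality would make x even,
  hence the norm even.\<close>

lemma odd_norm_ideal_generator_in_fundamental_domain:
  assumes "I \<in> nonzero_ideals" "odd (ideal_norm I)"
  obtains \<alpha> where "\<alpha> \<in> fundamental_domain" "I = zs_ideal \<alpha>"
proof -
  obtain \<beta> where \<beta>: "\<beta> \<noteq> (0, 0)" "I = zs_ideal \<beta>" using nonzero_ideal_principal[OF assms(1)] .
  let ?P = "\<lambda>\<alpha>. I = zs_ideal \<alpha> \<and> zs_norm \<alpha> > 0 \<and> fst \<alpha> > 0"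
  have "\<exists>\<gamma>. I = zs_ideal \<gamma> \<and> zs_norm \<gamma> > 0"
  proof (cases "zs_norm \<beta> > 0")
    case False
    then have "zs_norm \<beta> < 0" using \<beta>(1) zs_norm_eq_0_iff[of \<beta>] by linarith
    then have "zs_norm (zs_mult (1, 1) \<beta>) > 0" by (simp add: zs_norm_mult)
    moreover have "zs_ideal (zs_mult (1, 1) \<beta>) = I"
      using zs_ideal_zs_mult_unit[of "(-1, 1)" "(1, 1)" \<beta>] \<beta>(2) by simp
    ultimately show ?thesis by metis
  qed (use \<beta> in blast)
  then obtain \<gamma> where \<gamma>: "I = zs_ideal \<gamma>" "zs_norm \<gamma> > 0" by blast
  have "\<exists>\<alpha>. ?P \<alpha>"
  proof (cases "fst \<gamma> > 0")
    case False
    have "fst \<gamma> \<noteq> 0" using \<gamma>(2) zero_le_power2[of "snd \<gamma>"] by (auto simp: zs_norm_def)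
    then have "fst (zs_mult (-1, 0) \<gamma>) > 0" using False by (simp add: zs_mult_def)
    moreover have "zs_norm (zs_mult (-1, 0) \<gamma>) > 0" using \<gamma>(2) by (simp add: zs_norm_mult)
    moreover have "zs_ideal (zs_mult (-1, 0) \<gamma>) = I"
      using zs_ideal_zs_mult_unit[of "(-1, 0)" "(-1, 0)" \<gamma>] \<gamma>(1) by simp
    ultimately show ?thesis by metis
  qed (use \<gamma> in blast)
  \<comment> \<open>Multiplying by \<open>3 \<plusminus> 2 \<surd>2\<close> decreases \<open>x\<close> outside the fundamental domain.\<close>
  then obtain \<alpha> where \<alpha>: "?P \<alpha>" and min: "\<And>\<delta>. ?P \<delta> \<Longrightarrow> nat (fst \<alpha>) \<le> nat (fst \<delta>)"
    using arg_min_nat_lemma[of ?P _ "\<lambda>a. nat (fst a)"] by blast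
  obtain x y where xy: "\<alpha> = (x, y)" by (cases \<alpha>)
  have n: "x ^ 2 > 2 * y ^ 2" "x > 0" using \<alpha> xy by auto
  \<comment> \<open>Keeps 3x - 4y and 3x + 4y, the first coordinates after multiplication by 3 - 2
    sqrt 2 and 3 + 2 sqrt 2, positive.\<close>
  have pos: "3 * x > 4 * \<bar>y\<bar>"
  proof (rule power2_less_imp_less)
    have "16 * y ^ 2 < 9 * x ^ 2" using n(1) zero_le_power2[of y] by linarith
    then show "(4 * \<bar>y\<bar>) ^ 2 < (3 * x) ^ 2" by (simp add: power_mult_distrib)
  qed (use n in simp)
  have "2 * y \<le> x"
  proof (rule ccontr)
    assume "\<not> 2 * y \<le> x"
    have "?P (zs_mult (3, -2) \<alpha>)"
    proof (intro conjI)
      show "I = zs_ideal (zs_mult (3, -2) \<alpha>)"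
        using zs_ideal_zs_mult_unit[of "(3, 2)" "(3, -2)" \<alpha>] \<alpha> by simp
      show "zs_norm (zs_mult (3, -2) \<alpha>) > 0" using \<alpha> by (simp add: zs_norm_mult)
      show "fst (zs_mult (3, -2) \<alpha>) > 0" using pos by (simp add: xy)
    qed
    from min[OF this] show False using \<open>\<not> 2 * y \<le> x\<close> n pos by (simp add: xy)
  qed
  moreover have "- 2 * y \<le> x"
  proof (rule ccontr)
    assume "\<not> - 2 * y \<le> x"
    have "?P (zs_mult (3, 2) \<alpha>)"
    proof (intro conjI)
      show "I = zs_ideal (zs_mult (3, 2) \<alpha>)"
        using zs_ideal_zs_mult_unit[of "(3, -2)" "(3, 2)" \<alpha>] \<alpha> by simp
      show "zs_norm (zs_mult (3, 2) \<alpha>) > 0" using \<alpha> by (simp add: zs_norm_mult)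
      show "fst (zs_mult (3, 2) \<alpha>) > 0" using pos by (simp add: xy)
    qed
    from min[OF this] show False using \<open>\<not> - 2 * y \<le> x\<close> n pos by (simp add: xy)
  qed
  moreover have "odd x"
  proof -
    have "\<alpha> \<noteq> (0, 0)" using \<alpha> by auto
    then have "odd (nat \<bar>zs_norm \<alpha>\<bar>)" using assms(2) \<alpha> ideal_norm_zs_ideal by metis
    then have "odd (zs_norm \<alpha>)" by (simp add: even_nat_iff)
    then show ?thesis by (simp add: xy)
  qed
  then have "2 * y \<noteq> x" "- 2 * y \<noteq> x" by auto
  ultimately have "\<alpha> \<in> fundamental_domain" by (auto simp: fundamental_domain_def xy)
  with \<alpha> show ?thesis using that by blast
qed

lemma bij_betw_zs_ideal:
  assumes "odd k" "even m"
  shows "bij_betw zs_ideal {\<alpha> \<in> fundamental_domain. nat (zs_norm \<alpha>) mod m = k}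
           {I \<in> nonzero_ideals. ideal_norm I mod m = k}"
proof -
  have norm: "\<alpha> \<noteq> (0, 0)" "ideal_norm (zs_ideal \<alpha>) = nat (zs_norm \<alpha>)" if "\<alpha> \<in> fundamental_domain" for \<alpha>
  proof -
    have pos: "zs_norm \<alpha> > 0" using zs_norm_pos_iff_of_domain[of "fst \<alpha>" "snd \<alpha>"] that by simp
    then show "\<alpha> \<noteq> (0, 0)" by auto
    then show "ideal_norm (zs_ideal \<alpha>) = nat (zs_norm \<alpha>)" using pos by (simp add: ideal_norm_zs_ideal)
  qed
  have "{I \<in> nonzero_ideals. ideal_norm I mod m = k}
      = zs_ideal ` {\<alpha> \<in> fundamental_domain. nat (zs_norm \<alpha>) mod m = k}"
  proof (intro equalityI subsetI)
    fix I assume "I \<in> {I \<in> nonzero_ideals. ideal_norm I mod m = k}"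
    then have I: "I \<in> nonzero_ideals" "ideal_norm I mod m = k" by auto
    then have "odd (ideal_norm I)" using assms by (metis dvd_mod_iff)
    then obtain \<alpha> where "\<alpha> \<in> fundamental_domain" "I = zs_ideal \<alpha>"
      using odd_norm_ideal_generator_in_fundamental_domain[OF I(1)] by blast
    then show "I \<in> zs_ideal ` {\<alpha> \<in> fundamental_domain. nat (zs_norm \<alpha>) mod m = k}"
      using I(2) norm(2) by auto
  qed (use norm zs_ideal_in_nonzero_ideals in auto)
  then show ?thesis
    using inj_on_zs_ideal_fundamental_domain by (auto simp: bij_betw_def intro: inj_on_subset)
qed

section \<open>Matching exponents with norms\<close>

text \<open>Modulo 16 the form depends only on x mod 8 and y mod 4, so this is a finite check. It
  shows that the parametrizations by (r, i, e) miss no point.\<close>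

lemma mod_8_cases_of_norm:
  fixes x y k :: int
  assumes "(x ^ 2 - 2 * y ^ 2) mod 16 = k" "k = 7 \<or> k = 15"
  shows "odd y" "k = 7 \<Longrightarrow> x mod 8 = 3 \<or> x mod 8 = 5" "k = 15 \<Longrightarrow> x mod 8 = 1 \<or> x mod 8 = 7"
proof -
  define a b c d where "a = x div 8" and "b = x mod 8" and "c = y div 4" and "d = y mod 4"
  have x: "x = 8 * a + b" and y: "y = 4 * c + d" by (simp_all add: a_def b_def c_def d_def)
  have "x ^ 2 - 2 * y ^ 2 = (b ^ 2 - 2 * d ^ 2) + (4 * a ^ 2 + a * b - 2 * c ^ 2 - c * d) * 16"
    by (simp add: x y power2_eq_square algebra_simps)
  then have k: "(b ^ 2 - 2 * d ^ 2) mod 16 = k"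
    using assms(1) by (simp only: mod_mult_self1)
  have b: "b = 0 \<or> b = 1 \<or> b = 2 \<or> b = 3 \<or> b = 4 \<or> b = 5 \<or> b = 6 \<or> b = 7"
    unfolding b_def by presburger
  have d: "d = 0 \<or> d = 1 \<or> d = 2 \<or> d = 3"
    unfolding d_def by presburger
  have "odd d \<and> (k = 7 \<longrightarrow> b = 3 \<or> b = 5) \<and> (k = 15 \<longrightarrow> b = 1 \<or> b = 7)"
    using b d k assms(2) by (elim disjE) simp_all
  then show "odd y" "k = 7 \<Longrightarrow> x mod 8 = 3 \<or> x mod 8 = 5" "k = 15 \<Longrightarrow> x mod 8 = 1 \<or> x mod 8 = 7"
    by (simp_all add: y b_def)
qed

lemma has_sum_ideals_of_half_domain:
  fixes S :: complex
  assumes S: "((\<lambda>\<alpha>. f (nat (zs_norm \<alpha>))) has_sum S) {\<alpha> \<in> fundamental_domain. snd \<alpha> > 0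
      \<and> nat (zs_norm \<alpha>) mod m = k}"
    and y: "\<And>\<alpha>. \<alpha> \<in> fundamental_domain \<Longrightarrow> nat (zs_norm \<alpha>) mod m = k \<Longrightarrow> snd \<alpha> \<noteq> 0"
    and k: "odd k" "even m"
  shows "((\<lambda>I. f (ideal_norm I) / 2) has_sum S) {I \<in> nonzero_ideals. ideal_norm I mod m = k}"
proof -
  let ?D = "{\<alpha> \<in> fundamental_domain. nat (zs_norm \<alpha>) mod m = k}"
  let ?P = "{\<alpha> \<in> fundamental_domain. snd \<alpha> > 0 \<and> nat (zs_norm \<alpha>) mod m = k}"
  let ?N = "{\<alpha> \<in> fundamental_domain. snd \<alpha> < 0 \<and> nat (zs_norm \<alpha>) mod m = k}"
  let ?g = "\<lambda>\<alpha>. f (nat (zs_norm \<alpha>)) / 2"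
  have P: "(?g has_sum S / 2) ?P"
    using has_sum_cmult_left[OF S, of "1 / 2"] by simp
  have "(?g has_sum S / 2) ?P \<longleftrightarrow> (?g has_sum S / 2) ?N"
    by (rule has_sum_reindex_bij_witness[of _ "\<lambda>(x, y). (x, - y)" "\<lambda>(x, y). (x, - y)"])
       (auto simp: fundamental_domain_def)
  then have "(?g has_sum (S / 2 + S / 2)) (?P \<union> ?N)"
    using P by (intro has_sum_Un_disjoint) auto
  also have "?P \<union> ?N = ?D"
    using y by (auto simp: neq_iff)
  finally have "(?g has_sum S) ?D" by simp
  also have "?this \<longleftrightarrow> ((\<lambda>\<alpha>. f (ideal_norm (zs_ideal \<alpha>)) / 2) has_sum S) ?D"
  proof (intro has_sum_cong)
    fix \<alpha> assume "\<alpha> \<in> ?D"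
    then have "zs_norm \<alpha> > 0" using zs_norm_pos_iff_of_domain[of "fst \<alpha>" "snd \<alpha>"] by simp
    moreover from this have "\<alpha> \<noteq> (0, 0)" by auto
    ultimately show "?g \<alpha> = f (ideal_norm (zs_ideal \<alpha>)) / 2" by (simp add: ideal_norm_zs_ideal)
  qed
  finally show ?thesis
    using has_sum_reindex_bij_betw[OF bij_betw_zs_ideal[OF k]] by fast
qed

lemma int_two_times_choose_two: "2 * int (Suc i choose 2) = int i * (int i + 1)"
  using two_times_choose_two[of i] by (metis of_nat_1 of_nat_add of_nat_mult of_nat_numeral)

text \<open>Completing the square; e^2 = e makes the exponent linear in e, and \<open>le\<close>
  makes the natural subtraction exact.\<close>

lemma nat_zs_norm_even:
  assumes "i \<le> 2 * r" "e \<le> 1"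
  shows "nat (zs_norm (8 * int r + 3 + 2 * int e, 2 * int i + 1))
      = 16 * (4 * r ^ 2 + 3 * r + e * (2 * r + 1) - (Suc i choose 2)) + 7"
proof -
  have "Suc i choose 2 \<le> Suc (2 * r) choose 2" using assms by (intro binomial_right_mono) simp
  then have le: "Suc i choose 2 \<le> 4 * r ^ 2 + 3 * r + e * (2 * r + 1)" by (simp add: choose_two_double)
  have e: "e = 0 \<or> e = 1" using assms(2) by auto
  have "zs_norm (8 * int r + 3 + 2 * int e, 2 * int i + 1)
      = 16 * (4 * int r ^ 2 + 3 * int r + int e * (2 * int r + 1)) - 4 * (2 * (int i * (int i + 1))) + 7"
    using e by (auto simp: power2_eq_square algebra_simps)
  also have "\<dots> = 16 * (4 * int r ^ 2 + 3 * int r + int e * (2 * int r + 1) - int (Suc i choose 2)) + 7"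
    unfolding int_two_times_choose_two[symmetric] by simp
  also have "\<dots> = int (16 * (4 * r ^ 2 + 3 * r + e * (2 * r + 1) - (Suc i choose 2)) + 7)"
    using le e by (auto simp: of_nat_diff)
  finally show ?thesis by (simp only: nat_int)
qed

text \<open>Stated with \<open>Suc\<close> because the exponent is (norm + 1)/16. The strict
  inequality makes that exponent positive, so \<open>nat\<close> does not truncate the norm.\<close>

lemma nat_zs_norm_odd:
  assumes "i \<le> 2 * r + 1" "e \<le> 1"
  shows "Suc (nat (zs_norm (8 * int r + 7 + 2 * int e, 2 * int i + 1)))
      = 16 * (4 * r ^ 2 + 7 * r + 3 + e * (2 * r + 2) - (Suc i choose 2))"
    and "Suc i choose 2 < 4 * r ^ 2 + 7 * r + 3 + e * (2 * r + 2)"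
proof -
  have "Suc i choose 2 \<le> Suc (Suc (2 * r)) choose 2" using assms by (intro binomial_right_mono) simp
  then show lt: "Suc i choose 2 < 4 * r ^ 2 + 7 * r + 3 + e * (2 * r + 2)"
    by (simp add: choose_two_double_Suc)
  have e: "e = 0 \<or> e = 1" using assms(2) by auto
  have "zs_norm (8 * int r + 7 + 2 * int e, 2 * int i + 1) + 1
      = 16 * (4 * int r ^ 2 + 7 * int r + 3 + int e * (2 * int r + 2)) - 4 * (2 * (int i * (int i + 1)))"
    using e by (auto simp: power2_eq_square algebra_simps)
  also have "\<dots> = 16 * (4 * int r ^ 2 + 7 * int r + 3 + int e * (2 * int r + 2) - int (Suc i choose 2))"
    unfolding int_two_times_choose_two[symmetric] by simp
  also have "\<dots> = int (16 * (4 * r ^ 2 + 7 * r + 3 + e * (2 * r + 2) - (Suc i choose 2)))"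
    using lt e by (auto simp: of_nat_diff)
  finally have *: "zs_norm (8 * int r + 7 + 2 * int e, 2 * int i + 1) + 1
      = int (16 * (4 * r ^ 2 + 7 * r + 3 + e * (2 * r + 2) - (Suc i choose 2)))" .
  moreover have "16 * (4 * r ^ 2 + 7 * r + 3 + e * (2 * r + 2) - (Suc i choose 2)) > 0" using lt by simp
  ultimately show "Suc (nat (zs_norm (8 * int r + 7 + 2 * int e, 2 * int i + 1)))
      = 16 * (4 * r ^ 2 + 7 * r + 3 + e * (2 * r + 2) - (Suc i choose 2))"
    by linarith
qed

text \<open>A nonzero residue rules out the value 0 that \<open>nat\<close> takes on negative
  norms.\<close>

lemma zs_norm_mod_of_nat_mod:
  assumes "nat (zs_norm \<alpha>) mod 16 = k" "k > 0"
  shows "zs_norm \<alpha> mod 16 = int k"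
proof -
  have "zs_norm \<alpha> > 0" using assms by (cases "zs_norm \<alpha> > 0") auto
  then show ?thesis using assms(1) zmod_int[of "nat (zs_norm \<alpha>)" 16] by simp
qed

text \<open>For x = 8r + 3 + 2e and y = 2i + 1 with e in {0,1}, the condition 2y < x is exactly i <=
  2r, the range of the theta sum.\<close>

lemma has_sum_ideals_7_mod_16:
  assumes p: "norm p < 1" "p \<noteq> 0"
  shows "((\<lambda>I. p ^ (ideal_norm I div 16) / 2) has_sum bailey_series 0 p) {I \<in> nonzero_ideals. ideal_norm
      I mod 16 = 7}"
proof (rule has_sum_ideals_of_half_domain)
  let ?P = "{\<alpha> \<in> fundamental_domain. snd \<alpha> > 0 \<and> nat (zs_norm \<alpha>) mod 16 = 7}"
  have cases: "odd (snd \<alpha>)" "fst \<alpha> mod 8 = 3 \<or> fst \<alpha> mod 8 = 5" if "nat (zs_norm \<alpha>) mod 16 = 7" for \<alpha>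
    using mod_8_cases_of_norm(1,2)[of "fst \<alpha>" "snd \<alpha>" 7] zs_norm_mod_of_nat_mod[OF that]
        by (auto simp: zs_norm_def)
  show "snd \<alpha> \<noteq> 0" if "nat (zs_norm \<alpha>) mod 16 = 7" for \<alpha>
    using cases(1)[OF that] by auto
  have inverse: "(\<lambda>(x, y). (nat ((x - 3) div 8), nat ((y - 1) div 2), nat ((x - 3) mod 8 div 2)))
      (8 * int r + 3 + 2 * int e, 2 * int i + 1) = (r, i, e)" if "e \<le> 1" for r i e
    using that by (auto simp: le_Suc_eq)
  have coordinates: "\<exists>r i e. \<alpha> = (8 * int r + 3 + 2 * int e, 2 * int i + 1) \<and> i \<le> 2 * r \<and> e \<le> 1"
      if "\<alpha> \<in> ?P" for \<alpha>
  proof -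
    obtain x y where \<alpha>: "\<alpha> = (x, y)" by (cases \<alpha>)
    have *: "odd y" "x mod 8 = 3 \<or> x mod 8 = 5" "2 * y < x" "y > 0"
      using that cases[of \<alpha>] by (auto simp: \<alpha> fundamental_domain_def)
    obtain c where c: "y = 2 * c + 1" using *(1) by (rule oddE)
    define a where "a = x div 8"
    have x: "x = 8 * a + x mod 8" by (simp add: a_def)
    from *(2) show ?thesis
    proof
      assume "x mod 8 = 3"
      with x * c have "x = 8 * (a) + 3 + 2 * 0" "0 \<le> a" "0 \<le> c" "c \<le> 2 * a" by linarith+
      then show ?thesis
        using c by (intro exI[of _ "nat (a)"] exI[of _ "nat c"] exI[of _ "0"]) (auto simp: \<alpha> nat_le_iff)
    next
      assume "x mod 8 = 5"
      with x * c have "x = 8 * (a) + 3 + 2 * 1" "0 \<le> a" "0 \<le> c" "c \<le> 2 * a" by linarith+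
      then show ?thesis
        using c by (intro exI[of _ "nat (a)"] exI[of _ "nat c"] exI[of _ "1"]) (auto simp: \<alpha> nat_le_iff)
    qed
  qed
  have "((\<lambda>(r, i, e). p ^ (4 * r ^ 2 + 3 * r + e * (2 * r + 1) - (Suc i choose 2)))
      has_sum bailey_series 0 p)
           (Sigma UNIV (\<lambda>r. {..2 * r} \<times> {..1::nat}))"
    unfolding bailey_series_def by (rule has_sum_bailey_series_even[OF p])
  also have "?this \<longleftrightarrow> ((\<lambda>\<alpha>. p ^ (nat (zs_norm \<alpha>) div 16)) has_sum bailey_series 0 p) ?P"
  proof (rule has_sum_reindex_bij_witness[of _
      "\<lambda>(x, y). (nat ((x - 3) div 8), nat ((y - 1) div 2), nat ((x - 3) mod 8 div 2))"
      "\<lambda>(r, i, e). (8 * int r + 3 + 2 * int e, 2 * int i + 1)"], goal_cases)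
    case (1 a)
    then show ?case using inverse by auto
  next
    case (2 a)
    then show ?case
      by (auto simp: fundamental_domain_def nat_zs_norm_even simp del: zs_norm_simp)
  next
    case (3 \<alpha>)
    then show ?case using coordinates[of \<alpha>] inverse by (auto simp del: prod.case)
  next
    case (4 \<alpha>)
    then show ?case using coordinates[of \<alpha>] inverse by (auto simp del: prod.case)
  next
    case (5 a)
    then show ?case by (auto simp: nat_zs_norm_even simp del: zs_norm_simp)
  qed simp
  finally show "((\<lambda>\<alpha>. p ^ (nat (zs_norm \<alpha>) div 16)) has_sum bailey_series 0 p) ?P" .
qed simp_all

text \<open>For x = 8r + 7 + 2e and y = 2i + 1 with e in {0,1}, the condition 2y < x is exactly i <=
  2r + 1.\<close>

lemma has_sum_ideals_15_mod_16:
  assumes p: "norm p < 1" "p \<noteq> 0"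
  shows "((\<lambda>I. p ^ (Suc (ideal_norm I) div 16) / 2) has_sum (p ^ 2 * bailey_series 1 p))
      {I \<in> nonzero_ideals. ideal_norm I mod 16 = 15}"
proof (rule has_sum_ideals_of_half_domain)
  let ?P = "{\<alpha> \<in> fundamental_domain. snd \<alpha> > 0 \<and> nat (zs_norm \<alpha>) mod 16 = 15}"
  have cases: "odd (snd \<alpha>)" "fst \<alpha> mod 8 = 1 \<or> fst \<alpha> mod 8 = 7" if "nat (zs_norm \<alpha>) mod 16 = 15" for \<alpha>
    using mod_8_cases_of_norm(1,3)[of "fst \<alpha>" "snd \<alpha>" 15] zs_norm_mod_of_nat_mod[OF that]
        by (auto simp: zs_norm_def)
  show "snd \<alpha> \<noteq> 0" if "nat (zs_norm \<alpha>) mod 16 = 15" for \<alpha>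
    using cases(1)[OF that] by auto
  have inverse: "(\<lambda>(x, y). (nat ((x - 7) div 8), nat ((y - 1) div 2), nat ((x - 7) mod 8 div 2)))
      (8 * int r + 7 + 2 * int e, 2 * int i + 1) = (r, i, e)" if "e \<le> 1" for r i e
    using that by (auto simp: le_Suc_eq)
  have coordinates: "\<exists>r i e. \<alpha> = (8 * int r + 7 + 2 * int e, 2 * int i + 1) \<and> i \<le> 2 * r + 1 \<and> e \<le> 1"
      if "\<alpha> \<in> ?P" for \<alpha>
  proof -
    obtain x y where \<alpha>: "\<alpha> = (x, y)" by (cases \<alpha>)
    have *: "odd y" "x mod 8 = 1 \<or> x mod 8 = 7" "2 * y < x" "y > 0"
      using that cases[of \<alpha>] by (auto simp: \<alpha> fundamental_domain_def)
    obtain c where c: "y = 2 * c + 1" using *(1) by (rule oddE)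
    define a where "a = x div 8"
    have x: "x = 8 * a + x mod 8" by (simp add: a_def)
    from *(2) show ?thesis
    proof
      \<comment> \<open>This is e = 1, where x = 8r + 9, so that r = a - 1. That a >= 1 follows from
        x > 2y >= 2.\<close>
      assume "x mod 8 = 1"
      with x have x1: "x = 8 * a + 1" by simp
      have "1 \<le> y" using *(4) by simp
      with c have "0 \<le> c" by simp
      have "4 * c + 2 < 8 * a + 1" using *(3) c x1 by simp
      with \<open>0 \<le> c\<close> have "0 \<le> a - 1" "c \<le> 2 * (a - 1) + 1" by simp_all
      moreover have "x = 8 * (a - 1) + 7 + 2 * 1" using x1 by simp
      ultimately have "x = 8 * (a - 1) + 7 + 2 * 1" "0 \<le> a - 1" "0 \<le> c" "c \<le> 2 * (a - 1) + 1"
        using \<open>0 \<le> c\<close> by simp_all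
      then show ?thesis
        using c by (intro exI[of _ "nat (a - 1)"] exI[of _ "nat c"] exI[of _ "1"]) (auto simp: \<alpha> nat_le_iff)
    next
      assume "x mod 8 = 7"
      with x * c have "x = 8 * (a) + 7 + 2 * 0" "0 \<le> a" "0 \<le> c" "c \<le> 2 * a + 1" by linarith+
      then show ?thesis
        using c by (intro exI[of _ "nat (a)"] exI[of _ "nat c"] exI[of _ "0"]) (auto simp: \<alpha> nat_le_iff)
    qed
  qed
  have "((\<lambda>(r, i, e). p ^ (4 * r ^ 2 + 7 * r + 3 + e * (2 * r + 2) - (Suc i choose 2)))
      has_sum (p ^ 2 * bailey_series 1 p))
           (Sigma UNIV (\<lambda>r. {..2 * r + 1} \<times> {..1::nat}))"
    unfolding bailey_series_def by (rule has_sum_bailey_series_odd[OF p])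
  also have "?this \<longleftrightarrow> ((\<lambda>\<alpha>. p ^ (Suc (nat (zs_norm \<alpha>)) div 16)) has_sum (p ^ 2 * bailey_series 1 p)) ?P"
  proof (rule has_sum_reindex_bij_witness[of _
      "\<lambda>(x, y). (nat ((x - 7) div 8), nat ((y - 1) div 2), nat ((x - 7) mod 8 div 2))"
      "\<lambda>(r, i, e). (8 * int r + 7 + 2 * int e, 2 * int i + 1)"], goal_cases)
    case (1 a)
    then show ?case using inverse by auto
  next
    case (2 a)
    obtain r i e where a1: "a = (r, i, e)" by (cases a)
    have a: "a = (r, i, e)" "i \<le> 2 * r + 1" "e \<le> 1" using 2 by (simp_all add: a1)
    define N where "N = nat (zs_norm (8 * int r + 7 + 2 * int e, 2 * int i + 1))"
    have "n mod 16 = 15" if "Suc n = 16 * m" for n m :: nat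
      using that by (cases m) auto
    then have "N mod 16 = 15" unfolding N_def using nat_zs_norm_odd(1)[OF a(2,3)] .
    then show ?case
      using a(2,3) by (simp add: a(1) fundamental_domain_def N_def del: zs_norm_simp)
  next
    case (3 \<alpha>)
    then show ?case using coordinates[of \<alpha>] inverse by (auto simp del: prod.case)
  next
    case (4 \<alpha>)
    then show ?case using coordinates[of \<alpha>] inverse by (auto simp del: prod.case)
  next
    case (5 a)
    then show ?case by (auto simp: nat_zs_norm_odd simp del: zs_norm_simp)
  qed simp
  finally show "((\<lambda>\<alpha>. p ^ (Suc (nat (zs_norm \<alpha>)) div 16)) has_sum (p ^ 2 * bailey_series 1 p)) ?P" .
qed simp_all

section \<open>From residues modulo 16 to residues modulo 32\<close>

lemma Suc_div_16:
  assumes "n mod 16 = 15"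
  shows "Suc n div 16 = Suc (n div 16)"
proof -
  have "Suc n = Suc (n div 16) * 16" using div_mult_mod_eq[of n 16] assms by simp
  then show ?thesis by simp
qed

text \<open>Adding or subtracting the series at p and -p cancels one parity of the exponent. The
  constant \<open>c\<close> is the power of q that completes p^(h x) to q^norm.\<close>

lemma has_sum_even_odd_parts:
  fixes p c A B :: complex
  assumes A: "((\<lambda>x. p ^ h x / 2) has_sum A) X" and B: "((\<lambda>x. (- p) ^ h x / 2) has_sum B) X"
  shows "((\<lambda>x. c * p ^ h x / 2) has_sum (c * ((A + B) / 2))) {x \<in> X. even (h x)}"
    and "((\<lambda>x. c * p ^ h x / 2) has_sum (c * ((A - B) / 2))) {x \<in> X. odd (h x)}"
proof -
  have "((\<lambda>x. (p ^ h x / 2 + (- p) ^ h x / 2) * (c / 2)) has_sum ((A + B) * (c / 2))) X"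
    by (intro has_sum_cmult_left has_sum_add A B)
  also have "?this \<longleftrightarrow> ((\<lambda>x. c * p ^ h x / 2) has_sum ((A + B) * (c / 2))) {x \<in> X. even (h x)}"
    by (rule has_sum_cong_neutral) auto
  finally show "((\<lambda>x. c * p ^ h x / 2) has_sum (c * ((A + B) / 2))) {x \<in> X. even (h x)}"
    by (simp add: mult.commute)
  have "((\<lambda>x. (p ^ h x / 2 + (-1) * ((- p) ^ h x / 2)) * (c / 2)) has_sum ((A + (-1) * B) * (c / 2))) X"
    by (intro has_sum_cmult_left has_sum_cmult_right has_sum_add A B)
  also have "?this \<longleftrightarrow> ((\<lambda>x. c * p ^ h x / 2) has_sum ((A + (-1) * B) * (c / 2))) {x \<in> X. odd (h x)}"
    by (rule has_sum_cong_neutral) auto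
  finally show "((\<lambda>x. c * p ^ h x / 2) has_sum (c * ((A - B) / 2))) {x \<in> X. odd (h x)}"
    by (simp add: mult.commute)
qed

theorem theorem1p1:
  fixes q :: complex
  assumes "norm q < 1"
  shows "((\<lambda>I. q ^ ideal_norm I / 2) has_sum (q powi (-17) * L1 (q ^ 32)))
           {I \<in> nonzero_ideals. ideal_norm I mod 32 = 15}
       \<and> ((\<lambda>I. q ^ ideal_norm I / 2) has_sum (q powi 7 * L2 (q ^ 32)))
           {I \<in> nonzero_ideals. ideal_norm I mod 32 = 7}
       \<and> ((\<lambda>I. q ^ ideal_norm I / 2) has_sum (q powi (-33) * L3 (q ^ 32)))
           {I \<in> nonzero_ideals. ideal_norm I mod 32 = 31}
       \<and> ((\<lambda>I. q ^ ideal_norm I / 2) has_sum (q powi (-9) * L4 (q ^ 32)))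
           {I \<in> nonzero_ideals. ideal_norm I mod 32 = 23}"
proof (cases "q = 0")
  case True
  \<comment> \<open>At q = 0 the negative powers of q are 0 by convention, and the norms in these
    classes are positive, so both sides vanish.\<close>
  have "((\<lambda>I. 0 ^ ideal_norm I / 2) has_sum (0 :: complex)) {I \<in> nonzero_ideals. ideal_norm I mod 32 = k}"
      if "k > 0" for k
    using that by (intro has_sum_0) (auto simp: power_0_left)
  from this[of 15] this[of 7] this[of 31] this[of 23] show ?thesis
    by (simp add: True power_int_0_left)
next
  case False
  \<comment> \<open>Then Q = p^2 is q^32, and the parity of the exponent of p distinguishes the two
    residues modulo 32 above a residue modulo 16.\<close>
  define p where "p = q ^ 16"
  have p: "norm p < 1" "p \<noteq> 0" "norm (- p) < 1" "- p \<noteq> 0"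
    using assms False by (simp_all add: p_def norm_power power_less_one_iff)
  have pp: "q ^ 32 = p ^ 2" by (simp add: p_def flip: power_mult)
  have pow: "q ^ n * p ^ k = q ^ (n + 16 * k)" for n k
    by (simp add: p_def power_add power_mult)
  let ?E = "\<lambda>k. {I \<in> nonzero_ideals. ideal_norm I mod 32 = k}"
  note E = has_sum_even_odd_parts[OF has_sum_ideals_7_mod_16[OF p(1,2)]
      has_sum_ideals_7_mod_16[OF p(3,4)], of "q ^ 7"]
  note O = has_sum_even_odd_parts[OF has_sum_ideals_15_mod_16[OF p(1,2)]
      has_sum_ideals_15_mod_16[OF p(3,4)], of "inverse q"]
  have vE: "q ^ 7 * p ^ (ideal_norm I div 16) / 2 = q ^ ideal_norm I / 2" if "ideal_norm I mod 16 = 7" for I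
  proof -
    have "7 + 16 * (ideal_norm I div 16) = ideal_norm I"
      using that div_mult_mod_eq[of "ideal_norm I" 16] by simp
    then show ?thesis by (simp add: pow)
  qed
  have vO: "inverse q * p ^ (Suc (ideal_norm I) div 16) / 2 = q ^ ideal_norm I / 2"
      if "ideal_norm I mod 16 = 15" for I
  proof -
    have "16 * (Suc (ideal_norm I) div 16) = Suc (ideal_norm I)"
      using that div_mult_mod_eq[of "ideal_norm I" 16] by (simp add: Suc_div_16)
    then have "p ^ (Suc (ideal_norm I) div 16) = q * q ^ ideal_norm I"
      by (simp only: p_def power_mult[symmetric]) simp
    then show ?thesis using False by simp
  qed
  have i7: "q powi 7 = q ^ 7" by simp
  \<comment> \<open>The prefactors of the theorem compensate the factors p, p and p^2 in
    \<open>L4_eq\<close>, \<open>L1_eq\<close> and \<open>L3_eq\<close>, leaving q^7 or 1/q; the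
    factor p^2 common to L1 and L3 belongs to the series.\<close>
  have i9: "q powi (-9) * p = q ^ 7"
    using False by (simp add: p_def power_int_minus field_simps flip: power_add)
  have i17: "q powi (-17) * p = inverse q"
    using False by (simp add: p_def power_int_minus field_simps flip: power_add power_Suc)
  have i33: "q powi (-33) * p ^ 2 = inverse q"
    using False by (simp add: p_def power_int_minus field_simps flip: power_add power_Suc power_mult)
  have transfer: "(g has_sum t) B" if "(f has_sum s) A" "A = B" "\<And>x. x \<in> A \<Longrightarrow> f x = g x" "s = t"
    for f g :: "(int \<times> int) set \<Rightarrow> complex" and A B s t
    using that has_sum_cong by metis
  have mod_32: "n mod 16 = 7 \<and> even (n div 16) \<longleftrightarrow> n mod 32 = 7" "n mod 16 = 7 \<and> odd (n div 16) \<longleftrightarrow> n mod 32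
      = 23"
    "n mod 16 = 15 \<and> even (Suc n div 16) \<longleftrightarrow> n mod 32 = 31" "n mod 16 = 15 \<and> odd (Suc n div 16) \<longleftrightarrow> n mod 32
        = 15" for n :: nat
  proof -
    have m: "n mod 32 = 16 * (n div 16 mod 2) + n mod 16"
      using mod_mult2_eq[of n 16 2] by simp
    have "n div 16 mod 2 = 0 \<or> n div 16 mod 2 = 1" "n mod 16 < 16" by auto
    then show "n mod 16 = 7 \<and> even (n div 16) \<longleftrightarrow> n mod 32 = 7" "n mod 16 = 7 \<and> odd (n div 16) \<longleftrightarrow> n mod 32
        = 23"
      "n mod 16 = 15 \<and> even (Suc n div 16) \<longleftrightarrow> n mod 32 = 31" "n mod 16 = 15 \<and> odd (Suc n div 16) \<longleftrightarrow> n mod 32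
          = 15"
      unfolding m even_iff_mod_2_eq_zero by (auto simp: Suc_div_16 mod_Suc)
  qed
  have L1: "((\<lambda>I. q ^ ideal_norm I / 2) has_sum (q powi (-17) * L1 (q ^ 32)))
      {I \<in> nonzero_ideals. ideal_norm I mod 32 = 15}"
  proof (rule transfer[OF O(2) _ vO])
    show "inverse q * ((p ^ 2 * bailey_series 1 p - (- p) ^ 2 * bailey_series 1 (- p)) / 2)
        = q powi (-17) * L1 (q ^ 32)"
      unfolding pp L1_eq[OF p(1)] i17[symmetric] by (simp add: algebra_simps)
    show "{x \<in> {I \<in> nonzero_ideals. ideal_norm I mod 16 = 15}. odd (Suc (ideal_norm x) div 16)}
        = {I \<in> nonzero_ideals. ideal_norm I mod 32 = 15}"
      using mod_32[of "ideal_norm _"] by auto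
  qed simp
  have L2: "((\<lambda>I. q ^ ideal_norm I / 2) has_sum (q powi 7 * L2 (q ^ 32))) {I \<in> nonzero_ideals. ideal_norm
      I mod 32 = 7}"
  proof (rule transfer[OF E(1) _ vE])
    show "q ^ 7 * ((bailey_series 0 p + bailey_series 0 (- p)) / 2) = q powi 7 * L2 (q ^ 32)"
      unfolding pp L2_eq[OF p(1)] i7[symmetric] by (simp add: algebra_simps)
    show "{x \<in> {I \<in> nonzero_ideals. ideal_norm I mod 16 = 7}. even (ideal_norm x div 16)}
        = {I \<in> nonzero_ideals. ideal_norm I mod 32 = 7}"
      using mod_32[of "ideal_norm _"] by auto
  qed simp
  have L3: "((\<lambda>I. q ^ ideal_norm I / 2) has_sum (q powi (-33) * L3 (q ^ 32)))
      {I \<in> nonzero_ideals. ideal_norm I mod 32 = 31}"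
  proof (rule transfer[OF O(1) _ vO])
    show "inverse q * ((p ^ 2 * bailey_series 1 p + (- p) ^ 2 * bailey_series 1 (- p)) / 2)
        = q powi (-33) * L3 (q ^ 32)"
      unfolding pp L3_eq[OF p(1)] i33[symmetric] by (simp add: algebra_simps)
    show "{x \<in> {I \<in> nonzero_ideals. ideal_norm I mod 16 = 15}. even (Suc (ideal_norm x) div 16)}
        = {I \<in> nonzero_ideals. ideal_norm I mod 32 = 31}"
      using mod_32[of "ideal_norm _"] by auto
  qed simp
  have L4: "((\<lambda>I. q ^ ideal_norm I / 2) has_sum (q powi (-9) * L4 (q ^ 32)))
      {I \<in> nonzero_ideals. ideal_norm I mod 32 = 23}"
  proof (rule transfer[OF E(2) _ vE])
    show "q ^ 7 * ((bailey_series 0 p - bailey_series 0 (- p)) / 2) = q powi (-9) * L4 (q ^ 32)"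
      unfolding pp L4_eq[OF p(1)] i9[symmetric] by (simp add: algebra_simps)
    show "{x \<in> {I \<in> nonzero_ideals. ideal_norm I mod 16 = 7}. odd (ideal_norm x div 16)}
        = {I \<in> nonzero_ideals. ideal_norm I mod 32 = 23}"
      using mod_32[of "ideal_norm _"] by auto
  qed simp
  from L1 L2 L3 L4 show ?thesis by blast
qed

end
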